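(* Let $\mathbb{X}$ be an additive linear category with monoidal coalgebra modality $(!,\delta,\varepsilon,m_\otimes,m_K,\Delta,e)$, and let $\nabla:=(\delta\otimes\delta)m_\otimes!(\varepsilon\otimes e+e\otimes\varepsilon)$ and $u:=m_K!(0)$ be the multiplication and unit of the induced additive bialgebra modality. Then every deriving transformation $\mathsf{d}:{!A}\otimes A\to{!A}$ satisfies the monoidal rule $$(1\otimes\mathsf{d})\,m_\otimes=(\Delta\otimes1\otimes1)(1\otimes\sigma\otimes1)(m_\otimes\otimes\varepsilon\otimes1)\,\mathsf{d}:\ {!A}\otimes{!B}\otimes B\to{!(A\otimes B)}$$ and is induced by a codereliction for the induced additive bialgebra modality, i.e. there is a codereliction $\eta:A\to{!A}$ with $\mathsf{d}=(1\otimes\eta)\nabla$.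
   Context: Composition is in diagrammatic order ($fg$ means first $f$, then $g$). Symmetric monoidal categories are treated as strict (associators and unitors suppressed), with tensor $\otimes$, unit $K$, symmetry $\sigma:A\otimes B\to B\otimes A$. An additive symmetric monoidal category is a symmetric monoidal category enriched in commutative monoids (hom-sets have $+$ and $0$, no negatives, no biproducts assumed), with composition and $\otimes$ preserving $+$ and $0$ in each variable. A coalgebra modality $(!,\delta,\varepsilon,\Delta,e)$ is a comonad $(!,\delta,\varepsilon)$, $\delta:{!A}\to{!!A}$, $\varepsilon:{!A}\to A$, with natural transformations $\Delta:{!A}\to{!A}\otimes{!A}$, $e:{!A}\to K$ such that each $({!A},\Delta,e)$ is a cocommutative comonoid and $\delta\Delta=\Delta(\delta\otimes\delta)$. A monoidal coalgebra modality $(!,\delta,\varepsilon,m_\otimes,m_K,\Delta,e)$ is a coalgebra modality with a natural transformation $m_\otimes:{!A}\otimes{!B}\to{!(A\otimes B)}$ and a map $m_K:K\to{!K}$ such that: $(!,m_\otimes,m_K)$ is a (lax) symmetric monoidal endofunctor; $\delta,\varepsilon$ are monoidal: $m_\otimes\delta=(\delta\otimes\delta)m_\otimes!(m_\otimes)$, $m_K\delta=m_K!(m_K)$, $m_\otimes\varepsilon=\varepsilon\otimes\varepsilon$, $m_K\varepsilon=1$; $\Delta,e$ are monoidal: $m_\otimes\Delta=(\Delta\otimes\Delta)(1\otimes\sigma\otimes1)(m_\otimes\otimes m_\otimes)$, $m_\otimes e=e\otimes e$, $m_K\Delta=m_K\otimes m_K$, $m_Ke=1$; and $\Delta,e$ are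 $!$-coalgebra morphisms: $\delta\,!(\Delta)=\Delta(\delta\otimes\delta)m_\otimes$, $\delta\,!(e)=e\,m_K$. An additive linear category is an additive symmetric monoidal category equipped with a monoidal coalgebra modality. A bialgebra modality $(!,\delta,\varepsilon,\Delta,e,\nabla,u)$ is a coalgebra modality with natural transformations $\nabla:{!A}\otimes{!A}\to{!A}$, $u:K\to{!A}$ such that $({!A},\nabla,u)$ is a commutative monoid, $\nabla e=e\otimes e$, $u\Delta=u\otimes u$, $ue=1$, $\nabla\Delta=(\Delta\otimes\Delta)(1\otimes\sigma\otimes1)(\nabla\otimes\nabla)$, and $\nabla\varepsilon=\varepsilon\otimes e+e\otimes\varepsilon$. It is additive if for all parallel maps $f,g$: $!(f+g)=\Delta(!(f)\otimes!(g))\nabla$ and $!(0)=eu$. (For an additive linear category the $\nabla,u$ of the claim make the coalgebra modality an additive bialgebra modality.) A deriving transformation is a natural transformation $\mathsf{d}:{!A}\otimes A\to{!A}$ satisfying: constant rule $\mathsf{d}e=0$; product rule $\mathsf{d}\Delta=(\Delta\otimes1)((1\otimes\mathsf{d})+(1\otimes\sigma)(\mathsf{d}\otimes1))$; linear rule $\mathsf{d}\varepsilon=e\otimes1$; chain rule $\mathsf{d}\delta=(\Delta\otimes1)(\delta\otimes\mathsf{d})\mathsf{d}$ (the last $\mathsf{d}$ is at ${!A}$); interchange rule $(\mathsf{d}\otimes1)\mathsf{d}=(1\otimes\sigma)(\mathsf{d}\otimes1)\mathsf{d}$. A codereliction for a bialgebra modality is a natural transformation $\eta:A\to{!A}$ satisfying: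 $\eta e=0$; $\eta\Delta=\eta\otimes u+u\otimes\eta$; $\eta\varepsilon=1$; and $(1\otimes\eta)\nabla\delta=(\Delta\otimes\eta)(1\otimes\nabla)(\delta\otimes\eta)\nabla$ as maps ${!A}\otimes A\to{!!A}$. *)

theory Defs
  imports Main
begin

text \<open>
  Conventions. Composition is in diagrammatic order: \<open>f \<cdot> g\<close> is first \<open>f\<close>, then \<open>g\<close>.
  Symmetric monoidal categories are strict, so the associators and unitors are identities and
  the tensor of objects is associative and unital up to equality. A category has a set of objects
  and a set of arrows; the operations are total HOL functions about which nothing is assumed
  outside these sets. Symbols with subscript \<open>o\<close> act on objects; the others act on arrows. A
  family of arrows indexed by objects is a function of the index.
\<close>


section \<open>Strict symmetric monoidal categories\<close>

record ('o, 'm) cat =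
  Obj :: "'o set"
  Arr :: "'m set"
  src :: "'m \<Rightarrow> 'o"
  trg :: "'m \<Rightarrow> 'o"
  ident :: "'o \<Rightarrow> 'm"  ("\<one>\<index>")
  comp :: "'m \<Rightarrow> 'm \<Rightarrow> 'm"  (infixl "\<cdot>\<index>" 70)

definition in_hom :: "('o, 'm, 'z) cat_scheme \<Rightarrow> 'm \<Rightarrow> 'o \<Rightarrow> 'o \<Rightarrow> bool"
    ("\<guillemotleft>_ : _ \<rightarrow>\<index> _\<guillemotright>")
  where "\<guillemotleft>f : A \<rightarrow>\<^bsub>X\<^esub> B\<guillemotright> \<longleftrightarrow> f \<in> Arr X \<and> src X f = A \<and> trg X f = B"

locale category =
  fixes X :: "('o, 'm, 'z) cat_scheme" (structure)
  assumes src_obj: "f \<in> Arr X \<Longrightarrow> src X f \<in> Obj X"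
    and trg_obj: "f \<in> Arr X \<Longrightarrow> trg X f \<in> Obj X"
    and ident_hom: "A \<in> Obj X \<Longrightarrow> \<guillemotleft>\<one> A : A \<rightarrow> A\<guillemotright>"
    and comp_hom: "\<lbrakk>\<guillemotleft>f : A \<rightarrow> B\<guillemotright>; \<guillemotleft>g : B \<rightarrow> C\<guillemotright>\<rbrakk> \<Longrightarrow> \<guillemotleft>f \<cdot> g : A \<rightarrow> C\<guillemotright>"
    and ident_comp: "\<guillemotleft>f : A \<rightarrow> B\<guillemotright> \<Longrightarrow> \<one> A \<cdot> f = f"
    and comp_ident: "\<guillemotleft>f : A \<rightarrow> B\<guillemotright> \<Longrightarrow> f \<cdot> \<one> B = f"
    and comp_assoc:
      "\<lbrakk>\<guillemotleft>f : A \<rightarrow> B\<guillemotright>; \<guillemotleft>g : B \<rightarrow> C\<guillemotright>; \<guillemotleft>h : C \<rightarrow> D\<guillemotright>\<rbrakk> \<Longrightarrow> (f \<cdot> g) \<cdot> h = f \<cdot> (g \<cdot> h)"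

record ('o, 'm) smc = "('o, 'm) cat" +
  tensor_obj :: "'o \<Rightarrow> 'o \<Rightarrow> 'o"  (infixr "\<otimes>\<^sub>o\<index>" 80)
  tensor :: "'m \<Rightarrow> 'm \<Rightarrow> 'm"  (infixr "\<otimes>\<index>" 80)
  unit_obj :: 'o  ("\<K>\<index>")
  symm :: "'o \<Rightarrow> 'o \<Rightarrow> 'm"  ("\<sigma>\<index>")

locale symmetric_monoidal_category = category X
  for X :: "('o, 'm, 'z) smc_scheme" (structure) +
  assumes unit_obj: "\<K> \<in> Obj X"
    and tensor_obj: "\<lbrakk>A \<in> Obj X; B \<in> Obj X\<rbrakk> \<Longrightarrow> A \<otimes>\<^sub>o B \<in> Obj X"
    and tensor_obj_assoc:
      "\<lbrakk>A \<in> Obj X; B \<in> Obj X; C \<in> Obj X\<rbrakk> \<Longrightarrow> (A \<otimes>\<^sub>o B) \<otimes>\<^sub>o C = A \<otimes>\<^sub>o (B \<otimes>\<^sub>o C)"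
    and unit_tensor_obj: "A \<in> Obj X \<Longrightarrow> \<K> \<otimes>\<^sub>o A = A"
    and tensor_unit_obj: "A \<in> Obj X \<Longrightarrow> A \<otimes>\<^sub>o \<K> = A"
    and tensor_hom:
      "\<lbrakk>\<guillemotleft>f : A \<rightarrow> B\<guillemotright>; \<guillemotleft>g : C \<rightarrow> D\<guillemotright>\<rbrakk> \<Longrightarrow> \<guillemotleft>f \<otimes> g : A \<otimes>\<^sub>o C \<rightarrow> B \<otimes>\<^sub>o D\<guillemotright>"
    and tensor_ident: "\<lbrakk>A \<in> Obj X; B \<in> Obj X\<rbrakk> \<Longrightarrow> \<one> A \<otimes> \<one> B = \<one> (A \<otimes>\<^sub>o B)"
    and tensor_comp:
      "\<lbrakk>\<guillemotleft>f : A \<rightarrow> B\<guillemotright>; \<guillemotleft>g : B \<rightarrow> C\<guillemotright>; \<guillemotleft>h : A' \<rightarrow> B'\<guillemotright>; \<guillemotleft>k : B' \<rightarrow> C'\<guillemotright>\<rbrakk>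
        \<Longrightarrow> (f \<cdot> g) \<otimes> (h \<cdot> k) = (f \<otimes> h) \<cdot> (g \<otimes> k)"
    and tensor_assoc:
      "\<lbrakk>f \<in> Arr X; g \<in> Arr X; h \<in> Arr X\<rbrakk> \<Longrightarrow> (f \<otimes> g) \<otimes> h = f \<otimes> (g \<otimes> h)"
    and unit_tensor: "f \<in> Arr X \<Longrightarrow> \<one> \<K> \<otimes> f = f"
    and tensor_unit: "f \<in> Arr X \<Longrightarrow> f \<otimes> \<one> \<K> = f"
    and symm_hom: "\<lbrakk>A \<in> Obj X; B \<in> Obj X\<rbrakk> \<Longrightarrow> \<guillemotleft>\<sigma> A B : A \<otimes>\<^sub>o B \<rightarrow> B \<otimes>\<^sub>o A\<guillemotright>"
    and symm_natural:
      "\<lbrakk>\<guillemotleft>f : A \<rightarrow> A'\<guillemotright>; \<guillemotleft>g : B \<rightarrow> B'\<guillemotright>\<rbrakk> \<Longrightarrow> (f \<otimes> g) \<cdot> \<sigma> A' B' = \<sigma> A B \<cdot> (g \<otimes> f)"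
    and symm_symm: "\<lbrakk>A \<in> Obj X; B \<in> Obj X\<rbrakk> \<Longrightarrow> \<sigma> A B \<cdot> \<sigma> B A = \<one> (A \<otimes>\<^sub>o B)"
    and symm_unit: "A \<in> Obj X \<Longrightarrow> \<sigma> A \<K> = \<one> A"
    and symm_hexagon:
      "\<lbrakk>A \<in> Obj X; B \<in> Obj X; C \<in> Obj X\<rbrakk>
        \<Longrightarrow> \<sigma> A (B \<otimes>\<^sub>o C) = (\<sigma> A B \<otimes> \<one> C) \<cdot> (\<one> B \<otimes> \<sigma> A C)"


section \<open>Additive symmetric monoidal categories\<close>

record ('o, 'm) asmc = "('o, 'm) smc" +
  plus :: "'m \<Rightarrow> 'm \<Rightarrow> 'm"  (infixl "\<oplus>\<index>" 65)
  zero :: "'o \<Rightarrow> 'o \<Rightarrow> 'm"  ("\<zero>\<index>")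

text \<open>Here \<open>\<zero> A B\<close> is the zero map from \<open>A\<close> to \<open>B\<close>, and \<open>\<oplus>\<close> is the sum of parallel maps (not a
  biproduct).\<close>

locale additive_symmetric_monoidal_category = symmetric_monoidal_category X
  for X :: "('o, 'm, 'z) asmc_scheme" (structure) +
  assumes plus_hom: "\<lbrakk>\<guillemotleft>f : A \<rightarrow> B\<guillemotright>; \<guillemotleft>g : A \<rightarrow> B\<guillemotright>\<rbrakk> \<Longrightarrow> \<guillemotleft>f \<oplus> g : A \<rightarrow> B\<guillemotright>"
    and zero_hom: "\<lbrakk>A \<in> Obj X; B \<in> Obj X\<rbrakk> \<Longrightarrow> \<guillemotleft>\<zero> A B : A \<rightarrow> B\<guillemotright>"
    and plus_assoc:
      "\<lbrakk>\<guillemotleft>f : A \<rightarrow> B\<guillemotright>; \<guillemotleft>g : A \<rightarrow> B\<guillemotright>; \<guillemotleft>h : A \<rightarrow> B\<guillemotright>\<rbrakk> \<Longrightarrow> (f \<oplus> g) \<oplus> h = f \<oplus> (g \<oplus> h)"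
    and plus_commute: "\<lbrakk>\<guillemotleft>f : A \<rightarrow> B\<guillemotright>; \<guillemotleft>g : A \<rightarrow> B\<guillemotright>\<rbrakk> \<Longrightarrow> f \<oplus> g = g \<oplus> f"
    and zero_plus: "\<guillemotleft>f : A \<rightarrow> B\<guillemotright> \<Longrightarrow> \<zero> A B \<oplus> f = f"
    and plus_comp:
      "\<lbrakk>\<guillemotleft>f : A \<rightarrow> B\<guillemotright>; \<guillemotleft>g : A \<rightarrow> B\<guillemotright>; \<guillemotleft>h : B \<rightarrow> C\<guillemotright>\<rbrakk> \<Longrightarrow> (f \<oplus> g) \<cdot> h = f \<cdot> h \<oplus> g \<cdot> h"
    and comp_plus:
      "\<lbrakk>\<guillemotleft>h : A \<rightarrow> B\<guillemotright>; \<guillemotleft>f : B \<rightarrow> C\<guillemotright>; \<guillemotleft>g : B \<rightarrow> C\<guillemotright>\<rbrakk> \<Longrightarrow> h \<cdot> (f \<oplus> g) = h \<cdot> f \<oplus> h \<cdot> g"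
    and zero_comp: "\<lbrakk>A \<in> Obj X; \<guillemotleft>h : B \<rightarrow> C\<guillemotright>\<rbrakk> \<Longrightarrow> \<zero> A B \<cdot> h = \<zero> A C"
    and comp_zero: "\<lbrakk>\<guillemotleft>h : A \<rightarrow> B\<guillemotright>; C \<in> Obj X\<rbrakk> \<Longrightarrow> h \<cdot> \<zero> B C = \<zero> A C"
    and plus_tensor:
      "\<lbrakk>\<guillemotleft>f : A \<rightarrow> B\<guillemotright>; \<guillemotleft>g : A \<rightarrow> B\<guillemotright>; \<guillemotleft>h : C \<rightarrow> D\<guillemotright>\<rbrakk> \<Longrightarrow> (f \<oplus> g) \<otimes> h = f \<otimes> h \<oplus> g \<otimes> h"
    and tensor_plus:
      "\<lbrakk>\<guillemotleft>h : C \<rightarrow> D\<guillemotright>; \<guillemotleft>f : A \<rightarrow> B\<guillemotright>; \<guillemotleft>g : A \<rightarrow> B\<guillemotright>\<rbrakk> \<Longrightarrow> h \<otimes> (f \<oplus> g) = h \<otimes> f \<oplus> h \<otimes> g"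
    and zero_tensor:
      "\<lbrakk>A \<in> Obj X; B \<in> Obj X; \<guillemotleft>h : C \<rightarrow> D\<guillemotright>\<rbrakk> \<Longrightarrow> \<zero> A B \<otimes> h = \<zero> (A \<otimes>\<^sub>o C) (B \<otimes>\<^sub>o D)"
    and tensor_zero:
      "\<lbrakk>\<guillemotleft>h : C \<rightarrow> D\<guillemotright>; A \<in> Obj X; B \<in> Obj X\<rbrakk> \<Longrightarrow> h \<otimes> \<zero> A B = \<zero> (C \<otimes>\<^sub>o A) (D \<otimes>\<^sub>o B)"


section \<open>Coalgebra modalities\<close>

record ('o, 'm) coalg_mod = "('o, 'm) asmc" +
  bang_obj :: "'o \<Rightarrow> 'o"  ("!\<^sub>o\<index> _" [999] 999)
  bang :: "'m \<Rightarrow> 'm"  ("!\<^sub>m\<index> _" [999] 999)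
  comult :: "'o \<Rightarrow> 'm"  ("\<delta>\<index>")
  counit :: "'o \<Rightarrow> 'm"  ("\<epsilon>\<index>")
  dupl :: "'o \<Rightarrow> 'm"  ("\<Delta>\<index>")
  eras :: "'o \<Rightarrow> 'm"  ("\<e>\<index>")

locale coalgebra_modality = symmetric_monoidal_category X
  for X :: "('o, 'm, 'z) coalg_mod_scheme" (structure) +
  assumes bang_obj: "A \<in> Obj X \<Longrightarrow> !\<^sub>o A \<in> Obj X"
    and bang_hom: "\<guillemotleft>f : A \<rightarrow> B\<guillemotright> \<Longrightarrow> \<guillemotleft>!\<^sub>m f : !\<^sub>o A \<rightarrow> !\<^sub>o B\<guillemotright>"
    and bang_ident: "A \<in> Obj X \<Longrightarrow> !\<^sub>m (\<one> A) = \<one> (!\<^sub>o A)"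
    and bang_comp: "\<lbrakk>\<guillemotleft>f : A \<rightarrow> B\<guillemotright>; \<guillemotleft>g : B \<rightarrow> C\<guillemotright>\<rbrakk> \<Longrightarrow> !\<^sub>m (f \<cdot> g) = !\<^sub>m f \<cdot> !\<^sub>m g"
    \<comment> \<open>comonad\<close>
    and comult_hom: "A \<in> Obj X \<Longrightarrow> \<guillemotleft>\<delta> A : !\<^sub>o A \<rightarrow> !\<^sub>o !\<^sub>o A\<guillemotright>"
    and comult_natural: "\<guillemotleft>f : A \<rightarrow> B\<guillemotright> \<Longrightarrow> !\<^sub>m f \<cdot> \<delta> B = \<delta> A \<cdot> !\<^sub>m !\<^sub>m f"
    and counit_hom: "A \<in> Obj X \<Longrightarrow> \<guillemotleft>\<epsilon> A : !\<^sub>o A \<rightarrow> A\<guillemotright>"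
    and counit_natural: "\<guillemotleft>f : A \<rightarrow> B\<guillemotright> \<Longrightarrow> !\<^sub>m f \<cdot> \<epsilon> B = \<epsilon> A \<cdot> f"
    and comult_counit: "A \<in> Obj X \<Longrightarrow> \<delta> A \<cdot> \<epsilon> (!\<^sub>o A) = \<one> (!\<^sub>o A)"
    and comult_bang_counit: "A \<in> Obj X \<Longrightarrow> \<delta> A \<cdot> !\<^sub>m (\<epsilon> A) = \<one> (!\<^sub>o A)"
    and comult_comult: "A \<in> Obj X \<Longrightarrow> \<delta> A \<cdot> \<delta> (!\<^sub>o A) = \<delta> A \<cdot> !\<^sub>m (\<delta> A)"
    \<comment> \<open>cocommutative comonoids\<close>
    and dupl_hom: "A \<in> Obj X \<Longrightarrow> \<guillemotleft>\<Delta> A : !\<^sub>o A \<rightarrow> !\<^sub>o A \<otimes>\<^sub>o !\<^sub>o A\<guillemotright>"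
    and dupl_natural: "\<guillemotleft>f : A \<rightarrow> B\<guillemotright> \<Longrightarrow> !\<^sub>m f \<cdot> \<Delta> B = \<Delta> A \<cdot> (!\<^sub>m f \<otimes> !\<^sub>m f)"
    and eras_hom: "A \<in> Obj X \<Longrightarrow> \<guillemotleft>\<e> A : !\<^sub>o A \<rightarrow> \<K>\<guillemotright>"
    and eras_natural: "\<guillemotleft>f : A \<rightarrow> B\<guillemotright> \<Longrightarrow> !\<^sub>m f \<cdot> \<e> B = \<e> A"
    and dupl_assoc:
      "A \<in> Obj X \<Longrightarrow> \<Delta> A \<cdot> (\<Delta> A \<otimes> \<one> (!\<^sub>o A)) = \<Delta> A \<cdot> (\<one> (!\<^sub>o A) \<otimes> \<Delta> A)"
    and dupl_eras_left: "A \<in> Obj X \<Longrightarrow> \<Delta> A \<cdot> (\<e> A \<otimes> \<one> (!\<^sub>o A)) = \<one> (!\<^sub>o A)"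
    and dupl_eras_right: "A \<in> Obj X \<Longrightarrow> \<Delta> A \<cdot> (\<one> (!\<^sub>o A) \<otimes> \<e> A) = \<one> (!\<^sub>o A)"
    and dupl_commute: "A \<in> Obj X \<Longrightarrow> \<Delta> A \<cdot> \<sigma> (!\<^sub>o A) (!\<^sub>o A) = \<Delta> A"
    and comult_dupl: "A \<in> Obj X \<Longrightarrow> \<delta> A \<cdot> \<Delta> (!\<^sub>o A) = \<Delta> A \<cdot> (\<delta> A \<otimes> \<delta> A)"


section \<open>Additive linear categories\<close>

record ('o, 'm) mon_coalg_mod = "('o, 'm) coalg_mod" +
  mtens :: "'o \<Rightarrow> 'o \<Rightarrow> 'm"  ("m\<^sub>\<otimes>\<index>")
  munit :: 'm  ("m\<^sub>\<K>\<index>")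

locale monoidal_coalgebra_modality = coalgebra_modality X
  for X :: "('o, 'm, 'z) mon_coalg_mod_scheme" (structure) +
  \<comment> \<open>lax symmetric monoidal endofunctor\<close>
  assumes mtens_hom:
      "\<lbrakk>A \<in> Obj X; B \<in> Obj X\<rbrakk> \<Longrightarrow> \<guillemotleft>m\<^sub>\<otimes> A B : !\<^sub>o A \<otimes>\<^sub>o !\<^sub>o B \<rightarrow> !\<^sub>o (A \<otimes>\<^sub>o B)\<guillemotright>"
    and mtens_natural:
      "\<lbrakk>\<guillemotleft>f : A \<rightarrow> A'\<guillemotright>; \<guillemotleft>g : B \<rightarrow> B'\<guillemotright>\<rbrakk>
        \<Longrightarrow> (!\<^sub>m f \<otimes> !\<^sub>m g) \<cdot> m\<^sub>\<otimes> A' B' = m\<^sub>\<otimes> A B \<cdot> !\<^sub>m (f \<otimes> g)"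
    and munit_hom: "\<guillemotleft>m\<^sub>\<K> : \<K> \<rightarrow> !\<^sub>o \<K>\<guillemotright>"
    and mtens_assoc:
      "\<lbrakk>A \<in> Obj X; B \<in> Obj X; C \<in> Obj X\<rbrakk>
        \<Longrightarrow> (m\<^sub>\<otimes> A B \<otimes> \<one> (!\<^sub>o C)) \<cdot> m\<^sub>\<otimes> (A \<otimes>\<^sub>o B) C = (\<one> (!\<^sub>o A) \<otimes> m\<^sub>\<otimes> B C) \<cdot> m\<^sub>\<otimes> A (B \<otimes>\<^sub>o C)"
    and munit_left: "A \<in> Obj X \<Longrightarrow> (m\<^sub>\<K> \<otimes> \<one> (!\<^sub>o A)) \<cdot> m\<^sub>\<otimes> \<K> A = \<one> (!\<^sub>o A)"
    and munit_right: "A \<in> Obj X \<Longrightarrow> (\<one> (!\<^sub>o A) \<otimes> m\<^sub>\<K>) \<cdot> m\<^sub>\<otimes> A \<K> = \<one> (!\<^sub>o A)"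
    and mtens_symm:
      "\<lbrakk>A \<in> Obj X; B \<in> Obj X\<rbrakk>
        \<Longrightarrow> \<sigma> (!\<^sub>o A) (!\<^sub>o B) \<cdot> m\<^sub>\<otimes> B A = m\<^sub>\<otimes> A B \<cdot> !\<^sub>m (\<sigma> A B)"
    \<comment> \<open>\<open>\<delta>\<close> and \<open>\<epsilon>\<close> are monoidal\<close>
    and mtens_comult:
      "\<lbrakk>A \<in> Obj X; B \<in> Obj X\<rbrakk>
        \<Longrightarrow> m\<^sub>\<otimes> A B \<cdot> \<delta> (A \<otimes>\<^sub>o B) = (\<delta> A \<otimes> \<delta> B) \<cdot> m\<^sub>\<otimes> (!\<^sub>o A) (!\<^sub>o B) \<cdot> !\<^sub>m (m\<^sub>\<otimes> A B)"
    and munit_comult: "m\<^sub>\<K> \<cdot> \<delta> \<K> = m\<^sub>\<K> \<cdot> !\<^sub>m m\<^sub>\<K>"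
    and mtens_counit:
      "\<lbrakk>A \<in> Obj X; B \<in> Obj X\<rbrakk> \<Longrightarrow> m\<^sub>\<otimes> A B \<cdot> \<epsilon> (A \<otimes>\<^sub>o B) = \<epsilon> A \<otimes> \<epsilon> B"
    and munit_counit: "m\<^sub>\<K> \<cdot> \<epsilon> \<K> = \<one> \<K>"
    \<comment> \<open>\<open>\<Delta>\<close> and \<open>\<e>\<close> are monoidal\<close>
    and mtens_dupl:
      "\<lbrakk>A \<in> Obj X; B \<in> Obj X\<rbrakk>
        \<Longrightarrow> m\<^sub>\<otimes> A B \<cdot> \<Delta> (A \<otimes>\<^sub>o B) =
            (\<Delta> A \<otimes> \<Delta> B) \<cdot> (\<one> (!\<^sub>o A) \<otimes> \<sigma> (!\<^sub>o A) (!\<^sub>o B) \<otimes> \<one> (!\<^sub>o B)) \<cdot> (m\<^sub>\<otimes> A B \<otimes> m\<^sub>\<otimes> A B)"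
    and mtens_eras: "\<lbrakk>A \<in> Obj X; B \<in> Obj X\<rbrakk> \<Longrightarrow> m\<^sub>\<otimes> A B \<cdot> \<e> (A \<otimes>\<^sub>o B) = \<e> A \<otimes> \<e> B"
    and munit_dupl: "m\<^sub>\<K> \<cdot> \<Delta> \<K> = m\<^sub>\<K> \<otimes> m\<^sub>\<K>"
    and munit_eras: "m\<^sub>\<K> \<cdot> \<e> \<K> = \<one> \<K>"
    \<comment> \<open>\<open>\<Delta>\<close> and \<open>\<e>\<close> are morphisms of coalgebras for the comonad\<close>
    and comult_bang_dupl:
      "A \<in> Obj X \<Longrightarrow> \<delta> A \<cdot> !\<^sub>m (\<Delta> A) = \<Delta> A \<cdot> (\<delta> A \<otimes> \<delta> A) \<cdot> m\<^sub>\<otimes> (!\<^sub>o A) (!\<^sub>o A)"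
    and comult_bang_eras: "A \<in> Obj X \<Longrightarrow> \<delta> A \<cdot> !\<^sub>m (\<e> A) = \<e> A \<cdot> m\<^sub>\<K>"

locale additive_linear_category =
  additive_symmetric_monoidal_category X + monoidal_coalgebra_modality X
  for X :: "('o, 'm, 'z) mon_coalg_mod_scheme" (structure)

definition ind_mult :: "('o, 'm, 'z) mon_coalg_mod_scheme \<Rightarrow> 'o \<Rightarrow> 'm"  ("\<nabla>\<index>")
  where "\<nabla>\<^bsub>X\<^esub> A =
    (\<delta>\<^bsub>X\<^esub> A \<otimes>\<^bsub>X\<^esub> \<delta>\<^bsub>X\<^esub> A) \<cdot>\<^bsub>X\<^esub> m\<^sub>\<otimes>\<^bsub>X\<^esub> (!\<^sub>o\<^bsub>X\<^esub> A) (!\<^sub>o\<^bsub>X\<^esub> A) \<cdot>\<^bsub>X\<^esub>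
    !\<^sub>m\<^bsub>X\<^esub> (\<epsilon>\<^bsub>X\<^esub> A \<otimes>\<^bsub>X\<^esub> \<e>\<^bsub>X\<^esub> A \<oplus>\<^bsub>X\<^esub> \<e>\<^bsub>X\<^esub> A \<otimes>\<^bsub>X\<^esub> \<epsilon>\<^bsub>X\<^esub> A)"

definition ind_unit :: "('o, 'm, 'z) mon_coalg_mod_scheme \<Rightarrow> 'o \<Rightarrow> 'm"  ("\<u>\<index>")
  where "\<u>\<^bsub>X\<^esub> A = m\<^sub>\<K>\<^bsub>X\<^esub> \<cdot>\<^bsub>X\<^esub> !\<^sub>m\<^bsub>X\<^esub> (\<zero>\<^bsub>X\<^esub> \<K>\<^bsub>X\<^esub> A)"


section \<open>Bialgebra modalities and coderelictions\<close>

locale bialgebra_modality =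
  additive_symmetric_monoidal_category X + coalgebra_modality X
  for X :: "('o, 'm, 'z) coalg_mod_scheme" (structure)
    and mult :: "'o \<Rightarrow> 'm"
    and unit :: "'o \<Rightarrow> 'm" +
  assumes mult_hom: "A \<in> Obj X \<Longrightarrow> \<guillemotleft>mult A : !\<^sub>o A \<otimes>\<^sub>o !\<^sub>o A \<rightarrow> !\<^sub>o A\<guillemotright>"
    and mult_natural: "\<guillemotleft>f : A \<rightarrow> B\<guillemotright> \<Longrightarrow> (!\<^sub>m f \<otimes> !\<^sub>m f) \<cdot> mult B = mult A \<cdot> !\<^sub>m f"
    and unit_hom: "A \<in> Obj X \<Longrightarrow> \<guillemotleft>unit A : \<K> \<rightarrow> !\<^sub>o A\<guillemotright>"
    and unit_natural: "\<guillemotleft>f : A \<rightarrow> B\<guillemotright> \<Longrightarrow> unit A \<cdot> !\<^sub>m f = unit B"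
    and mult_assoc:
      "A \<in> Obj X \<Longrightarrow> (mult A \<otimes> \<one> (!\<^sub>o A)) \<cdot> mult A = (\<one> (!\<^sub>o A) \<otimes> mult A) \<cdot> mult A"
    and unit_mult: "A \<in> Obj X \<Longrightarrow> (unit A \<otimes> \<one> (!\<^sub>o A)) \<cdot> mult A = \<one> (!\<^sub>o A)"
    and mult_unit: "A \<in> Obj X \<Longrightarrow> (\<one> (!\<^sub>o A) \<otimes> unit A) \<cdot> mult A = \<one> (!\<^sub>o A)"
    and mult_commute: "A \<in> Obj X \<Longrightarrow> \<sigma> (!\<^sub>o A) (!\<^sub>o A) \<cdot> mult A = mult A"
    and mult_eras: "A \<in> Obj X \<Longrightarrow> mult A \<cdot> \<e> A = \<e> A \<otimes> \<e> A"
    and unit_dupl: "A \<in> Obj X \<Longrightarrow> unit A \<cdot> \<Delta> A = unit A \<otimes> unit A"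
    and unit_eras: "A \<in> Obj X \<Longrightarrow> unit A \<cdot> \<e> A = \<one> \<K>"
    and mult_dupl:
      "A \<in> Obj X \<Longrightarrow> mult A \<cdot> \<Delta> A =
        (\<Delta> A \<otimes> \<Delta> A) \<cdot> (\<one> (!\<^sub>o A) \<otimes> \<sigma> (!\<^sub>o A) (!\<^sub>o A) \<otimes> \<one> (!\<^sub>o A)) \<cdot> (mult A \<otimes> mult A)"
    and mult_counit: "A \<in> Obj X \<Longrightarrow> mult A \<cdot> \<epsilon> A = \<epsilon> A \<otimes> \<e> A \<oplus> \<e> A \<otimes> \<epsilon> A"

locale codereliction = bialgebra_modality X mult unit
  for X :: "('o, 'm, 'z) coalg_mod_scheme" (structure)
    and mult :: "'o \<Rightarrow> 'm"
    and unit :: "'o \<Rightarrow> 'm" +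
  fixes coder :: "'o \<Rightarrow> 'm"
  assumes coder_hom: "A \<in> Obj X \<Longrightarrow> \<guillemotleft>coder A : A \<rightarrow> !\<^sub>o A\<guillemotright>"
    and coder_natural: "\<guillemotleft>f : A \<rightarrow> B\<guillemotright> \<Longrightarrow> f \<cdot> coder B = coder A \<cdot> !\<^sub>m f"
    and coder_eras: "A \<in> Obj X \<Longrightarrow> coder A \<cdot> \<e> A = \<zero> A \<K>"
    and coder_dupl: "A \<in> Obj X \<Longrightarrow> coder A \<cdot> \<Delta> A = coder A \<otimes> unit A \<oplus> unit A \<otimes> coder A"
    and coder_counit: "A \<in> Obj X \<Longrightarrow> coder A \<cdot> \<epsilon> A = \<one> A"
    and coder_chain:
      "A \<in> Obj X \<Longrightarrow> (\<one> (!\<^sub>o A) \<otimes> coder A) \<cdot> mult A \<cdot> \<delta> A =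
        (\<Delta> A \<otimes> coder A) \<cdot> (\<one> (!\<^sub>o A) \<otimes> mult A) \<cdot> (\<delta> A \<otimes> coder (!\<^sub>o A)) \<cdot> mult (!\<^sub>o A)"


section \<open>Deriving transformations\<close>

locale deriving_transformation =
  additive_symmetric_monoidal_category X + coalgebra_modality X
  for X :: "('o, 'm, 'z) coalg_mod_scheme" (structure) +
  fixes d :: "'o \<Rightarrow> 'm"
  assumes d_hom: "A \<in> Obj X \<Longrightarrow> \<guillemotleft>d A : !\<^sub>o A \<otimes>\<^sub>o A \<rightarrow> !\<^sub>o A\<guillemotright>"
    and d_natural: "\<guillemotleft>f : A \<rightarrow> B\<guillemotright> \<Longrightarrow> (!\<^sub>m f \<otimes> f) \<cdot> d B = d A \<cdot> !\<^sub>m f"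
    and constant_rule: "A \<in> Obj X \<Longrightarrow> d A \<cdot> \<e> A = \<zero> (!\<^sub>o A \<otimes>\<^sub>o A) \<K>"
    and product_rule:
      "A \<in> Obj X \<Longrightarrow> d A \<cdot> \<Delta> A =
        (\<Delta> A \<otimes> \<one> A) \<cdot>
        (\<one> (!\<^sub>o A) \<otimes> d A \<oplus> (\<one> (!\<^sub>o A) \<otimes> \<sigma> (!\<^sub>o A) A) \<cdot> (d A \<otimes> \<one> (!\<^sub>o A)))"
    and linear_rule: "A \<in> Obj X \<Longrightarrow> d A \<cdot> \<epsilon> A = \<e> A \<otimes> \<one> A"
    and chain_rule:
      "A \<in> Obj X \<Longrightarrow> d A \<cdot> \<delta> A = (\<Delta> A \<otimes> \<one> A) \<cdot> (\<delta> A \<otimes> d A) \<cdot> d (!\<^sub>o A)"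
    and interchange_rule:
      "A \<in> Obj X \<Longrightarrow>
        (d A \<otimes> \<one> A) \<cdot> d A = (\<one> (!\<^sub>o A) \<otimes> \<sigma> A A) \<cdot> (d A \<otimes> \<one> A) \<cdot> d A"

end

theory Submission
  imports Defs
begin

text \<open>
  The tensor product \<open>W = !A \<otimes> !B\<close> is a coalgebra for the comonad, with structure
  \<open>w = (\<delta> \<otimes> \<delta>) m\<^sub>\<otimes> : W \<rightarrow> !W\<close>, and behaves like a product with the projections \<open>f = \<epsilon> \<otimes> e\<close> and
  \<open>g = e \<otimes> \<epsilon>\<close>: with \<open>c\<close> the comultiplication of \<open>W\<close>, one has \<open>w \<Delta> (!f \<otimes> !g) = 1\<close>. Put
  \<open>D = 1 \<otimes> d : W \<otimes> B \<rightarrow> W\<close> and \<open>T = (c \<otimes> 1)(w \<otimes> D) : W \<otimes> B \<rightarrow> !W \<otimes> W\<close>. As \<open>D f = 0\<close>, the product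
  rule at \<open>W\<close> gives \<open>T d \<Delta> (!f \<otimes> !g) = D\<close>, which expresses the partial derivative \<open>D\<close> through the
  total derivative at \<open>W\<close>.

  Composing with \<open>m\<^sub>\<otimes>\<close>, and writing \<open>\<Delta> (!f \<otimes> !g) m\<^sub>\<otimes> = \<delta> !(q)\<close>, the chain rule yields the monoidal
  rule. Composing with \<open>\<nabla>\<close>, where \<open>\<Delta> (!f \<otimes> !g) \<nabla> = !(f + g)\<close>, naturality yields
  \<open>(1 \<otimes> d) \<nabla> = (\<nabla> \<otimes> 1) d\<close>, so that \<open>d = (1 \<otimes> \<eta>) \<nabla>\<close> for \<open>\<eta> = (u \<otimes> 1) d\<close>; the codereliction axioms are
  the rules for \<open>d\<close> precomposed with \<open>u\<close>.
\<close>

section \<open>Strict symmetric monoidal categories\<close>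

context category
begin

lemma arr_obj [simp]: "f \<in> Arr X \<Longrightarrow> src X f \<in> Obj X" "f \<in> Arr X \<Longrightarrow> trg X f \<in> Obj X"
  using src_obj trg_obj by auto

lemma ident_arr [simp]:
  "A \<in> Obj X \<Longrightarrow> \<one> A \<in> Arr X" "A \<in> Obj X \<Longrightarrow> src X (\<one> A) = A" "A \<in> Obj X \<Longrightarrow> trg X (\<one> A) = A"
  using ident_hom by (auto simp: in_hom_def)

lemma comp_arr [simp]:
  assumes "f \<in> Arr X" "g \<in> Arr X" "trg X f = src X g"
  shows "f \<cdot> g \<in> Arr X" "src X (f \<cdot> g) = src X f" "trg X (f \<cdot> g) = trg X g"
  using comp_hom[of f "src X f" "trg X f" g "trg X g"] assms by (auto simp: in_hom_def)

lemma ident_left [simp]: "\<lbrakk>f \<in> Arr X; src X f = A\<rbrakk> \<Longrightarrow> \<one> A \<cdot> f = f"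
  using ident_comp[of f A "trg X f"] by (auto simp: in_hom_def)

lemma ident_right [simp]: "\<lbrakk>f \<in> Arr X; trg X f = A\<rbrakk> \<Longrightarrow> f \<cdot> \<one> A = f"
  using comp_ident[of f "src X f" A] by (auto simp: in_hom_def)

lemma assoc [simp]:
  "\<lbrakk>f \<in> Arr X; g \<in> Arr X; h \<in> Arr X; trg X f = src X g; trg X g = src X h\<rbrakk>
    \<Longrightarrow> (f \<cdot> g) \<cdot> h = f \<cdot> (g \<cdot> h)"
  using comp_assoc[of f "src X f" "trg X f" g "trg X g" h "trg X h"] by (auto simp: in_hom_def)

text \<open>Composites are kept associated to the right, so the left side of an equation
  \<open>f \<cdot> g = k\<close> is broken up as soon as something follows it. This form applies
  such an equation at the front of a longer composite.\<close>

lemma rewrite_head: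
  "\<lbrakk>f \<cdot> g = k; f \<in> Arr X; g \<in> Arr X; h \<in> Arr X; trg X f = src X g; trg X g = src X h\<rbrakk>
    \<Longrightarrow> f \<cdot> (g \<cdot> h) = k \<cdot> h"
  using assoc[of f g h] by simp

end

context symmetric_monoidal_category
begin

declare unit_obj [simp] tensor_obj [simp] tensor_obj_assoc [simp] unit_tensor_obj [simp]
  tensor_unit_obj [simp] tensor_ident [simp] tensor_assoc [simp] unit_tensor [simp]
  tensor_unit [simp] symm_symm [simp] symm_unit [simp]

lemma tensor_arr [simp]:
  assumes "f \<in> Arr X" "g \<in> Arr X"
  shows "f \<otimes> g \<in> Arr X" "src X (f \<otimes> g) = src X f \<otimes>\<^sub>o src X g"
    "trg X (f \<otimes> g) = trg X f \<otimes>\<^sub>o trg X g"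
  using tensor_hom[of f "src X f" "trg X f" g "src X g" "trg X g"] assms by (auto simp: in_hom_def)

lemma symm_arr [simp]:
  assumes "A \<in> Obj X" "B \<in> Obj X"
  shows "\<sigma> A B \<in> Arr X" "src X (\<sigma> A B) = A \<otimes>\<^sub>o B" "trg X (\<sigma> A B) = B \<otimes>\<^sub>o A"
  using symm_hom[of A B] assms by (auto simp: in_hom_def)

lemma interchange:
  "\<lbrakk>f \<in> Arr X; g \<in> Arr X; h \<in> Arr X; k \<in> Arr X; trg X f = src X h; trg X g = src X k\<rbrakk>
    \<Longrightarrow> (f \<otimes> g) \<cdot> (h \<otimes> k) = (f \<cdot> h) \<otimes> (g \<cdot> k)"
  using tensor_comp[of f "src X f" "trg X f" h "trg X h" g "src X g" "trg X g" k "trg X k"]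
  by (auto simp: in_hom_def)

text \<open>The analogue of \<open>rewrite_head\<close> for \<open>interchange\<close>. Neither form
  is a simp rule, because tensors of composites sometimes have to be split rather than
  fused.\<close>

lemma interchange_head:
  "\<lbrakk>f \<in> Arr X; g \<in> Arr X; h \<in> Arr X; k \<in> Arr X; trg X f = src X h; trg X g = src X k;
    l \<in> Arr X; src X l = trg X h \<otimes>\<^sub>o trg X k\<rbrakk>
    \<Longrightarrow> (f \<otimes> g) \<cdot> ((h \<otimes> k) \<cdot> l) = ((f \<cdot> h) \<otimes> (g \<cdot> k)) \<cdot> l"
  by (subst interchange[symmetric]) auto

text \<open>With tensors associated to the right, two adjacent leading identities no longer form a
  subterm that \<open>tensor_ident\<close> matches; this rule fuses them nevertheless.\<close>

lemma ident_tensor_ident_tensor [simp]: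
  "\<lbrakk>A \<in> Obj X; B \<in> Obj X; f \<in> Arr X\<rbrakk> \<Longrightarrow> \<one> A \<otimes> \<one> B \<otimes> f = \<one> (A \<otimes>\<^sub>o B) \<otimes> f"
  by (subst tensor_assoc[symmetric]) auto

lemma symm_unit_left [simp]: "A \<in> Obj X \<Longrightarrow> \<sigma> \<K> A = \<one> A"
  using symm_symm[of A \<K>] symm_unit[of A] by simp

lemma symm_nat:
  "\<lbrakk>f \<in> Arr X; g \<in> Arr X; src X f = A; src X g = B; trg X f = A'; trg X g = B'\<rbrakk>
    \<Longrightarrow> (f \<otimes> g) \<cdot> \<sigma> A' B' = \<sigma> A B \<cdot> (g \<otimes> f)"
  using symm_natural[of f A A' g B B'] by (auto simp: in_hom_def)

lemma middle_exchange_nat: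
  assumes [simp]: "f \<in> Arr X" "g \<in> Arr X" "h \<in> Arr X" "k \<in> Arr X"
  shows "(f \<otimes> g \<otimes> h \<otimes> k) \<cdot> (\<one> (trg X f) \<otimes> \<sigma> (trg X g) (trg X h) \<otimes> \<one> (trg X k)) =
    (\<one> (src X f) \<otimes> \<sigma> (src X g) (src X h) \<otimes> \<one> (src X k)) \<cdot> (f \<otimes> h \<otimes> g \<otimes> k)"
proof -
  let ?s = "\<sigma> (src X g) (src X h)" and ?t = "\<sigma> (trg X g) (trg X h)"
  \<comment> \<open>\<open>tensor_assoc\<close> is withheld so that the two middle factors stay one
    block, on which naturality of \<sigma> acts.\<close>
  have "(f \<otimes> (g \<otimes> h) \<otimes> k) \<cdot> (\<one> (trg X f) \<otimes> ?t \<otimes> \<one> (trg X k)) = f \<otimes> ((g \<otimes> h) \<cdot> ?t) \<otimes> k"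
    by (simp add: interchange del: tensor_assoc)
  also have "\<dots> = f \<otimes> (?s \<cdot> (h \<otimes> g)) \<otimes> k"
    by (simp add: symm_nat)
  also have "\<dots> = (\<one> (src X f) \<otimes> ?s \<otimes> \<one> (src X k)) \<cdot> (f \<otimes> (h \<otimes> g) \<otimes> k)"
    by (simp add: interchange del: tensor_assoc)
  finally show ?thesis by simp
qed

end

section \<open>Additive structure\<close>

context additive_symmetric_monoidal_category
begin

lemma plus_arr [simp]:
  assumes "f \<in> Arr X" "g \<in> Arr X" "src X f = src X g" "trg X f = trg X g"
  shows "f \<oplus> g \<in> Arr X" "src X (f \<oplus> g) = src X g" "trg X (f \<oplus> g) = trg X g"
  using plus_hom[of f "src X f" "trg X f" g] assms by (auto simp: in_hom_def)

lemma zero_arr [simp]: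
  assumes "A \<in> Obj X" "B \<in> Obj X"
  shows "\<zero> A B \<in> Arr X" "src X (\<zero> A B) = A" "trg X (\<zero> A B) = B"
  using zero_hom[of A B] assms by (auto simp: in_hom_def)

lemma comp_distrib_right:
  "\<lbrakk>f \<in> Arr X; g \<in> Arr X; h \<in> Arr X; src X f = src X g; trg X f = trg X g; trg X g = src X h\<rbrakk>
    \<Longrightarrow> (f \<oplus> g) \<cdot> h = f \<cdot> h \<oplus> g \<cdot> h"
  using plus_comp[of f "src X f" "trg X f" g h "trg X h"] by (auto simp: in_hom_def)

lemma comp_distrib_left:
  "\<lbrakk>f \<in> Arr X; g \<in> Arr X; h \<in> Arr X; src X f = src X g; trg X f = trg X g; trg X h = src X g\<rbrakk>
    \<Longrightarrow> h \<cdot> (f \<oplus> g) = h \<cdot> f \<oplus> h \<cdot> g"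
  using comp_plus[of h "src X h" "trg X h" f "trg X f" g] by (auto simp: in_hom_def)

lemma tensor_distrib_right:
  "\<lbrakk>f \<in> Arr X; g \<in> Arr X; h \<in> Arr X; src X f = src X g; trg X f = trg X g\<rbrakk>
    \<Longrightarrow> (f \<oplus> g) \<otimes> h = f \<otimes> h \<oplus> g \<otimes> h"
  using plus_tensor[of f "src X f" "trg X f" g h "src X h" "trg X h"] by (auto simp: in_hom_def)

lemma tensor_distrib_left:
  "\<lbrakk>f \<in> Arr X; g \<in> Arr X; h \<in> Arr X; src X f = src X g; trg X f = trg X g\<rbrakk>
    \<Longrightarrow> h \<otimes> (f \<oplus> g) = h \<otimes> f \<oplus> h \<otimes> g"
  using tensor_plus[of h "src X h" "trg X h" f "src X f" "trg X f" g] by (auto simp: in_hom_def)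

lemma zero_left [simp]: "\<lbrakk>f \<in> Arr X; src X f = A; trg X f = B\<rbrakk> \<Longrightarrow> \<zero> A B \<oplus> f = f"
  using zero_plus[of f A B] by (auto simp: in_hom_def)

lemma zero_right [simp]: "\<lbrakk>f \<in> Arr X; src X f = A; trg X f = B\<rbrakk> \<Longrightarrow> f \<oplus> \<zero> A B = f"
  using zero_left[of f A B] plus_commute[of f A B "\<zero> A B"] zero_hom[of A B] arr_obj[of f]
  by (auto simp: in_hom_def)

lemma plus_comm:
  "\<lbrakk>f \<in> Arr X; g \<in> Arr X; src X f = src X g; trg X f = trg X g\<rbrakk> \<Longrightarrow> f \<oplus> g = g \<oplus> f"
  using plus_commute[of f "src X f" "trg X f" g] by (auto simp: in_hom_def)

lemma plus_assoc_arr: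
  "\<lbrakk>f \<in> Arr X; g \<in> Arr X; h \<in> Arr X; src X f = src X g; trg X f = trg X g;
    src X g = src X h; trg X g = trg X h\<rbrakk> \<Longrightarrow> (f \<oplus> g) \<oplus> h = f \<oplus> (g \<oplus> h)"
  using plus_assoc[of f "src X f" "trg X f" g h] by (auto simp: in_hom_def)

lemma zero_comp_arr [simp]:
  "\<lbrakk>A \<in> Obj X; h \<in> Arr X; src X h = B\<rbrakk> \<Longrightarrow> \<zero> A B \<cdot> h = \<zero> A (trg X h)"
  using zero_comp[of A h B "trg X h"] by (auto simp: in_hom_def)

lemma comp_zero_arr [simp]:
  "\<lbrakk>C \<in> Obj X; h \<in> Arr X; trg X h = B\<rbrakk> \<Longrightarrow> h \<cdot> \<zero> B C = \<zero> (src X h) C"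
  using comp_zero[of h "src X h" B C] by (auto simp: in_hom_def)

lemma zero_tensor_arr [simp]:
  "\<lbrakk>A \<in> Obj X; B \<in> Obj X; h \<in> Arr X\<rbrakk> \<Longrightarrow> \<zero> A B \<otimes> h = \<zero> (A \<otimes>\<^sub>o src X h) (B \<otimes>\<^sub>o trg X h)"
  using zero_tensor[of A B h "src X h" "trg X h"] by (auto simp: in_hom_def)

lemma tensor_zero_arr [simp]:
  "\<lbrakk>A \<in> Obj X; B \<in> Obj X; h \<in> Arr X\<rbrakk> \<Longrightarrow> h \<otimes> \<zero> A B = \<zero> (src X h \<otimes>\<^sub>o A) (trg X h \<otimes>\<^sub>o B)"
  using tensor_zero[of h "src X h" "trg X h" A B] by (auto simp: in_hom_def)

end

section \<open>Tensor products of cofree coalgebras\<close>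

context coalgebra_modality
begin

declare bang_obj [simp] bang_ident [simp]

lemma bang_arr [simp]:
  assumes "f \<in> Arr X"
  shows "!\<^sub>m f \<in> Arr X" "src X (!\<^sub>m f) = !\<^sub>o (src X f)" "trg X (!\<^sub>m f) = !\<^sub>o (trg X f)"
  using bang_hom[of f "src X f" "trg X f"] assms by (auto simp: in_hom_def)

lemma modality_arr [simp]:
  assumes "A \<in> Obj X"
  shows "\<delta> A \<in> Arr X" "src X (\<delta> A) = !\<^sub>o A" "trg X (\<delta> A) = !\<^sub>o !\<^sub>o A"
    "\<epsilon> A \<in> Arr X" "src X (\<epsilon> A) = !\<^sub>o A" "trg X (\<epsilon> A) = A"
    "\<Delta> A \<in> Arr X" "src X (\<Delta> A) = !\<^sub>o A" "trg X (\<Delta> A) = !\<^sub>o A \<otimes>\<^sub>o !\<^sub>o A"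
    "\<e> A \<in> Arr X" "src X (\<e> A) = !\<^sub>o A" "trg X (\<e> A) = \<K>"
  using comult_hom[of A] counit_hom[of A] dupl_hom[of A] eras_hom[of A] assms
  by (auto simp: in_hom_def)

lemma bang_comp_arr:
  "\<lbrakk>f \<in> Arr X; g \<in> Arr X; trg X f = src X g\<rbrakk> \<Longrightarrow> !\<^sub>m (f \<cdot> g) = !\<^sub>m f \<cdot> !\<^sub>m g"
  using bang_comp[of f "src X f" "trg X f" g "trg X g"] by (auto simp: in_hom_def)

lemma comult_nat:
  "\<lbrakk>f \<in> Arr X; src X f = A; trg X f = B\<rbrakk> \<Longrightarrow> !\<^sub>m f \<cdot> \<delta> B = \<delta> A \<cdot> !\<^sub>m !\<^sub>m f"
  using comult_natural[of f A B] by (auto simp: in_hom_def)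

lemma counit_nat:
  "\<lbrakk>f \<in> Arr X; src X f = A; trg X f = B\<rbrakk> \<Longrightarrow> !\<^sub>m f \<cdot> \<epsilon> B = \<epsilon> A \<cdot> f"
  using counit_natural[of f A B] by (auto simp: in_hom_def)

lemma dupl_nat:
  "\<lbrakk>f \<in> Arr X; src X f = A; trg X f = B\<rbrakk> \<Longrightarrow> !\<^sub>m f \<cdot> \<Delta> B = \<Delta> A \<cdot> (!\<^sub>m f \<otimes> !\<^sub>m f)"
  using dupl_natural[of f A B] by (auto simp: in_hom_def)

lemma eras_nat: "\<lbrakk>f \<in> Arr X; src X f = A; trg X f = B\<rbrakk> \<Longrightarrow> !\<^sub>m f \<cdot> \<e> B = \<e> A"
  using eras_natural[of f A B] by (auto simp: in_hom_def)

text \<open>Naturality of \<open>\<e>\<close> along \<epsilon> introduces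
  \<open>!\<^sub>m (\<epsilon> A)\<close>, which cancels against \<delta>.\<close>

lemma comult_eras:
  assumes [simp]: "A \<in> Obj X"
  shows "\<delta> A \<cdot> \<e> (!\<^sub>o A) = \<e> A"
proof -
  have "\<delta> A \<cdot> \<e> (!\<^sub>o A) = \<delta> A \<cdot> !\<^sub>m (\<epsilon> A) \<cdot> \<e> A"
    by (simp add: eras_nat)
  also have "\<dots> = \<e> A"
    by (simp add: rewrite_head[OF comult_bang_counit])
  finally show ?thesis .
qed

end

context monoidal_coalgebra_modality
begin

lemma monoidal_arr [simp]:
  assumes "A \<in> Obj X" "B \<in> Obj X"
  shows "m\<^sub>\<otimes> A B \<in> Arr X" "src X (m\<^sub>\<otimes> A B) = !\<^sub>o A \<otimes>\<^sub>o !\<^sub>o B" "trg X (m\<^sub>\<otimes> A B) = !\<^sub>o (A \<otimes>\<^sub>o B)"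
  using mtens_hom[of A B] assms by (auto simp: in_hom_def)

lemma munit_arr [simp]: "m\<^sub>\<K> \<in> Arr X" "src X m\<^sub>\<K> = \<K>" "trg X m\<^sub>\<K> = !\<^sub>o \<K>"
  using munit_hom by (auto simp: in_hom_def)

lemma mtens_nat:
  "\<lbrakk>f \<in> Arr X; g \<in> Arr X; src X f = A; src X g = B; trg X f = A'; trg X g = B'\<rbrakk>
    \<Longrightarrow> (!\<^sub>m f \<otimes> !\<^sub>m g) \<cdot> m\<^sub>\<otimes> A' B' = m\<^sub>\<otimes> A B \<cdot> !\<^sub>m (f \<otimes> g)"
  using mtens_natural[of f A A' g B B'] by (auto simp: in_hom_def)

text \<open>The structure map of the tensor product of two cofree coalgebras, taken among coalgebras
  of the comonad; it is the \<open>w\<close> of the overview.\<close>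

definition tensor_comult :: "'o \<Rightarrow> 'o \<Rightarrow> 'm"
  where "tensor_comult A B = (\<delta> A \<otimes> \<delta> B) \<cdot> m\<^sub>\<otimes> (!\<^sub>o A) (!\<^sub>o B)"

text \<open>The comultiplication of a tensor product of comonoids, the \<open>c\<close> of the
  overview.\<close>

definition tensor_dupl :: "'o \<Rightarrow> 'o \<Rightarrow> 'm"
  where "tensor_dupl A B = (\<Delta> A \<otimes> \<Delta> B) \<cdot> (\<one> (!\<^sub>o A) \<otimes> \<sigma> (!\<^sub>o A) (!\<^sub>o B) \<otimes> \<one> (!\<^sub>o B))"

lemma tensor_comult_arr [simp]:
  assumes "A \<in> Obj X" "B \<in> Obj X"
  shows "tensor_comult A B \<in> Arr X" "src X (tensor_comult A B) = !\<^sub>o A \<otimes>\<^sub>o !\<^sub>o B"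
    "trg X (tensor_comult A B) = !\<^sub>o (!\<^sub>o A \<otimes>\<^sub>o !\<^sub>o B)"
    "tensor_dupl A B \<in> Arr X" "src X (tensor_dupl A B) = !\<^sub>o A \<otimes>\<^sub>o !\<^sub>o B"
    "trg X (tensor_dupl A B) = !\<^sub>o A \<otimes>\<^sub>o !\<^sub>o B \<otimes>\<^sub>o !\<^sub>o A \<otimes>\<^sub>o !\<^sub>o B"
  using assms unfolding tensor_comult_def tensor_dupl_def by auto

lemma tensor_comult_counit:
  assumes [simp]: "A \<in> Obj X" "B \<in> Obj X"
  shows "tensor_comult A B \<cdot> \<epsilon> (!\<^sub>o A \<otimes>\<^sub>o !\<^sub>o B) = \<one> (!\<^sub>o A \<otimes>\<^sub>o !\<^sub>o B)"
  by (simp add: tensor_comult_def mtens_counit interchange comult_counit)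

text \<open>Monoidality of \<delta> produces two layers of \<delta> in each factor. Comonad
  coassociativity turns the outer layer into \<open>!\<^sub>m\<close> of \<delta>, and naturality of
  \<open>m\<^sub>\<otimes>\<close> collects everything under one \<open>!\<close>.\<close>

lemma tensor_comult_comult:
  assumes [simp]: "A \<in> Obj X" "B \<in> Obj X"
  shows "tensor_comult A B \<cdot> \<delta> (!\<^sub>o A \<otimes>\<^sub>o !\<^sub>o B) = tensor_comult A B \<cdot> !\<^sub>m (tensor_comult A B)"
proof -
  let ?A = "!\<^sub>o A" and ?B = "!\<^sub>o B"
  have "tensor_comult A B \<cdot> \<delta> (?A \<otimes>\<^sub>o ?B) =
      ((\<delta> A \<cdot> \<delta> ?A) \<otimes> (\<delta> B \<cdot> \<delta> ?B)) \<cdot> m\<^sub>\<otimes> (!\<^sub>o ?A) (!\<^sub>o ?B) \<cdot> !\<^sub>m (m\<^sub>\<otimes> ?A ?B)"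
    by (simp add: tensor_comult_def mtens_comult interchange_head)
  also have "\<dots> = (\<delta> A \<otimes> \<delta> B) \<cdot> (!\<^sub>m (\<delta> A) \<otimes> !\<^sub>m (\<delta> B)) \<cdot> m\<^sub>\<otimes> (!\<^sub>o ?A) (!\<^sub>o ?B) \<cdot> !\<^sub>m (m\<^sub>\<otimes> ?A ?B)"
    by (simp add: comult_comult interchange_head)
  also have "\<dots> = tensor_comult A B \<cdot> !\<^sub>m (tensor_comult A B)"
    by (simp add: tensor_comult_def bang_comp_arr rewrite_head[OF mtens_nat])
  finally show ?thesis .
qed

text \<open>Both ingredients of \<open>w\<close> respect comultiplication: \<delta> by
  \<open>comult_dupl\<close> and \<open>m\<^sub>\<otimes>\<close> by \<open>mtens_dupl\<close>. The
  middle exchange is natural, so it passes from one to the other.\<close>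

lemma tensor_comult_dupl:
  assumes [simp]: "A \<in> Obj X" "B \<in> Obj X"
  shows "tensor_comult A B \<cdot> \<Delta> (!\<^sub>o A \<otimes>\<^sub>o !\<^sub>o B) =
    tensor_dupl A B \<cdot> (tensor_comult A B \<otimes> tensor_comult A B)"
proof -
  let ?A = "!\<^sub>o A" and ?B = "!\<^sub>o B"
  let ?m = "m\<^sub>\<otimes> ?A ?B"
  have "tensor_comult A B \<cdot> \<Delta> (?A \<otimes>\<^sub>o ?B) =
      ((\<delta> A \<cdot> \<Delta> ?A) \<otimes> (\<delta> B \<cdot> \<Delta> ?B)) \<cdot>
      (\<one> (!\<^sub>o ?A) \<otimes> \<sigma> (!\<^sub>o ?A) (!\<^sub>o ?B) \<otimes> \<one> (!\<^sub>o ?B)) \<cdot> (?m \<otimes> ?m)"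
    by (simp add: tensor_comult_def mtens_dupl interchange_head)
  also have "\<dots> = (\<Delta> A \<otimes> \<Delta> B) \<cdot> ((\<delta> A \<otimes> \<delta> A \<otimes> \<delta> B \<otimes> \<delta> B) \<cdot>
      (\<one> (!\<^sub>o ?A) \<otimes> \<sigma> (!\<^sub>o ?A) (!\<^sub>o ?B) \<otimes> \<one> (!\<^sub>o ?B))) \<cdot> (?m \<otimes> ?m)"
    using interchange_head[of "\<Delta> A" "\<Delta> B" "\<delta> A \<otimes> \<delta> A" "\<delta> B \<otimes> \<delta> B"]
    by (simp add: comult_dupl)
  also have "\<dots> = (\<Delta> A \<otimes> \<Delta> B) \<cdot> ((\<one> ?A \<otimes> \<sigma> ?A ?B \<otimes> \<one> ?B) \<cdot>
      (\<delta> A \<otimes> \<delta> B \<otimes> \<delta> A \<otimes> \<delta> B)) \<cdot> (?m \<otimes> ?m)"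
    using middle_exchange_nat[of "\<delta> A" "\<delta> A" "\<delta> B" "\<delta> B"] by simp
  also have "\<dots> = tensor_dupl A B \<cdot> ((\<delta> A \<otimes> \<delta> B) \<otimes> (\<delta> A \<otimes> \<delta> B)) \<cdot> (?m \<otimes> ?m)"
    by (simp add: tensor_dupl_def)
  also have "\<dots> = tensor_dupl A B \<cdot> (tensor_comult A B \<otimes> tensor_comult A B)"
    using interchange[of "\<delta> A \<otimes> \<delta> B" "\<delta> A \<otimes> \<delta> B" ?m ?m] by (simp add: tensor_comult_def)
  finally show ?thesis .
qed

section \<open>Projections out of \<open>!A \<otimes> !B\<close> and the recombination of a
  pair\<close>

lemma tensor_comult_eras:
  assumes [simp]: "A \<in> Obj X" "B \<in> Obj X"
  shows "tensor_comult A B \<cdot> \<e> (!\<^sub>o A \<otimes>\<^sub>o !\<^sub>o B) = \<e> A \<otimes> \<e> B"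
  by (simp add: tensor_comult_def mtens_eras interchange comult_eras)

text \<open>As \<open>\<e>\<close> is a coalgebra morphism, lifting it along \<delta> leaves
  \<open>\<e>\<close> followed by \<open>m\<^sub>\<K>\<close>, which the unit law of
  \<open>m\<^sub>\<otimes>\<close> absorbs.\<close>

lemma tensor_comult_fst:
  assumes [simp]: "A \<in> Obj X" "B \<in> Obj X"
  shows "tensor_comult A B \<cdot> !\<^sub>m (\<epsilon> A \<otimes> \<e> B) = \<one> (!\<^sub>o A) \<otimes> \<e> B"
proof -
  have "tensor_comult A B \<cdot> !\<^sub>m (\<epsilon> A \<otimes> \<e> B) =
      (\<delta> A \<otimes> \<delta> B) \<cdot> (!\<^sub>m (\<epsilon> A) \<otimes> !\<^sub>m (\<e> B)) \<cdot> m\<^sub>\<otimes> A \<K>"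
    by (simp add: tensor_comult_def mtens_nat)
  also have "\<dots> = (\<one> (!\<^sub>o A) \<otimes> (\<e> B \<cdot> m\<^sub>\<K>)) \<cdot> m\<^sub>\<otimes> A \<K>"
    by (simp add: interchange_head comult_bang_counit comult_bang_eras)
  also have "\<dots> = (\<one> (!\<^sub>o A) \<otimes> \<e> B) \<cdot> (\<one> (!\<^sub>o A) \<otimes> m\<^sub>\<K>) \<cdot> m\<^sub>\<otimes> A \<K>"
    by (simp add: interchange_head)
  finally show ?thesis by (simp add: munit_right)
qed

lemma tensor_comult_snd:
  assumes [simp]: "A \<in> Obj X" "B \<in> Obj X"
  shows "tensor_comult A B \<cdot> !\<^sub>m (\<e> A \<otimes> \<epsilon> B) = \<e> A \<otimes> \<one> (!\<^sub>o B)"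
proof -
  have "tensor_comult A B \<cdot> !\<^sub>m (\<e> A \<otimes> \<epsilon> B) =
      (\<delta> A \<otimes> \<delta> B) \<cdot> (!\<^sub>m (\<e> A) \<otimes> !\<^sub>m (\<epsilon> B)) \<cdot> m\<^sub>\<otimes> \<K> B"
    by (simp add: tensor_comult_def mtens_nat)
  also have "\<dots> = ((\<e> A \<cdot> m\<^sub>\<K>) \<otimes> \<one> (!\<^sub>o B)) \<cdot> m\<^sub>\<otimes> \<K> B"
    by (simp add: interchange_head comult_bang_counit comult_bang_eras)
  also have "\<dots> = (\<e> A \<otimes> \<one> (!\<^sub>o B)) \<cdot> (m\<^sub>\<K> \<otimes> \<one> (!\<^sub>o B)) \<cdot> m\<^sub>\<otimes> \<K> B"
    by (simp add: interchange_head)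
  finally show ?thesis by (simp add: munit_left)
qed

text \<open>The two erasures pass through the middle symmetry, which becomes trivial at
  \<open>\<K>\<close>; what remains is one counit law in each factor.\<close>

lemma tensor_dupl_fst_snd:
  assumes [simp]: "A \<in> Obj X" "B \<in> Obj X"
  shows "tensor_dupl A B \<cdot> (\<one> (!\<^sub>o A) \<otimes> \<e> B \<otimes> \<e> A \<otimes> \<one> (!\<^sub>o B)) = \<one> (!\<^sub>o A \<otimes>\<^sub>o !\<^sub>o B)"
proof -
  have "tensor_dupl A B \<cdot> (\<one> (!\<^sub>o A) \<otimes> \<e> B \<otimes> \<e> A \<otimes> \<one> (!\<^sub>o B)) =
     (\<Delta> A \<otimes> \<Delta> B) \<cdot> (\<one> (!\<^sub>o A) \<otimes> \<e> A \<otimes> \<e> B \<otimes> \<one> (!\<^sub>o B))"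
    using middle_exchange_nat[of "\<one> (!\<^sub>o A)" "\<e> A" "\<e> B" "\<one> (!\<^sub>o B)"]
    by (simp add: tensor_dupl_def)
  also have "\<dots> = (\<Delta> A \<otimes> \<Delta> B) \<cdot> ((\<one> (!\<^sub>o A) \<otimes> \<e> A) \<otimes> (\<e> B \<otimes> \<one> (!\<^sub>o B)))"
    by simp
  also have "\<dots> = \<one> (!\<^sub>o A \<otimes>\<^sub>o !\<^sub>o B)"
    by (subst interchange) (simp_all add: dupl_eras_left dupl_eras_right)
  finally show ?thesis .
qed

lemma tensor_comult_dupl_fst_snd:
  assumes [simp]: "A \<in> Obj X" "B \<in> Obj X"
  shows "tensor_comult A B \<cdot> \<Delta> (!\<^sub>o A \<otimes>\<^sub>o !\<^sub>o B) \<cdot> (!\<^sub>m (\<epsilon> A \<otimes> \<e> B) \<otimes> !\<^sub>m (\<e> A \<otimes> \<epsilon> B)) =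
    \<one> (!\<^sub>o A \<otimes>\<^sub>o !\<^sub>o B)"
  using tensor_dupl_fst_snd[of A B]
  by (simp add: rewrite_head[OF tensor_comult_dupl] interchange tensor_comult_fst tensor_comult_snd)

text \<open>Since \<open>\<epsilon>\<close> is a retraction of the coalgebra structure, coassociativity of the comultiplication of
  \<open>!A \<otimes> !B\<close> is inherited from \<open>!(!A \<otimes> !B)\<close>, with no computation with symmetries.\<close>

lemma tensor_dupl_alt:
  assumes [simp]: "A \<in> Obj X" "B \<in> Obj X"
    and [simp]: "f \<in> Arr X" "g \<in> Arr X" "src X f = !\<^sub>o A \<otimes>\<^sub>o !\<^sub>o B" "src X g = !\<^sub>o A \<otimes>\<^sub>o !\<^sub>o B"
  defines "W \<equiv> !\<^sub>o A \<otimes>\<^sub>o !\<^sub>o B"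
  shows "tensor_dupl A B \<cdot> (f \<otimes> g) = tensor_comult A B \<cdot> \<Delta> W \<cdot> ((\<epsilon> W \<cdot> f) \<otimes> (\<epsilon> W \<cdot> g))"
  by (simp add: W_def rewrite_head[OF tensor_comult_dupl] interchange
      rewrite_head[OF tensor_comult_counit])

lemma tensor_dupl_assoc:
  assumes [simp]: "A \<in> Obj X" "B \<in> Obj X"
  defines "W \<equiv> !\<^sub>o A \<otimes>\<^sub>o !\<^sub>o B"
  shows "tensor_dupl A B \<cdot> (tensor_dupl A B \<otimes> \<one> W) = tensor_dupl A B \<cdot> (\<one> W \<otimes> tensor_dupl A B)"
proof -
  let ?c = "tensor_dupl A B" and ?w = "tensor_comult A B"
  have [simp]: "W \<in> Obj X" "src X ?w = W" "trg X ?w = !\<^sub>o W" "src X ?c = W" "trg X ?c = W \<otimes>\<^sub>o W"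
    by (simp_all add: W_def)
  \<comment> \<open>The case of two identities. Rewriting the inner \<open>c\<close> this way moves
    the computation to \<open>!W\<close>, where \<open>dupl_assoc\<close> applies.\<close>
  have c: "?c = ?w \<cdot> \<Delta> W \<cdot> (\<epsilon> W \<otimes> \<epsilon> W)"
    using tensor_dupl_alt[of A B "\<one> W" "\<one> W"] by (simp add: W_def)
  have w: "?w \<cdot> \<epsilon> W = \<one> W" and d: "?w \<cdot> \<Delta> W = ?c \<cdot> (?w \<otimes> ?w)"
    using tensor_comult_counit[of A B] tensor_comult_dupl[of A B] by (simp_all add: W_def)
  have "?c \<cdot> (?c \<otimes> \<one> W) = ?c \<cdot> (?w \<otimes> ?w) \<cdot> ((\<Delta> W \<cdot> (\<epsilon> W \<otimes> \<epsilon> W)) \<otimes> \<epsilon> W)"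
    by (subst (2) c) (simp add: interchange w)
  also have "\<dots> = ?w \<cdot> (\<Delta> W \<cdot> (\<Delta> W \<otimes> \<one> (!\<^sub>o W))) \<cdot> (\<epsilon> W \<otimes> \<epsilon> W \<otimes> \<epsilon> W)"
    using interchange[of "\<Delta> W" "\<one> (!\<^sub>o W)" "\<epsilon> W \<otimes> \<epsilon> W" "\<epsilon> W"]
    by (simp add: d[symmetric])
  also have "\<dots> = ?w \<cdot> \<Delta> W \<cdot> (\<epsilon> W \<otimes> (\<Delta> W \<cdot> (\<epsilon> W \<otimes> \<epsilon> W)))"
    using interchange[of "\<one> (!\<^sub>o W)" "\<Delta> W" "\<epsilon> W" "\<epsilon> W \<otimes> \<epsilon> W"]
    by (simp add: dupl_assoc)
  also have "\<dots> = ?c \<cdot> (\<one> W \<otimes> ?c)"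
    by (subst (2) c) (simp add: rewrite_head[OF d] interchange w)
  finally show ?thesis .
qed

text \<open>This counit law too is inherited from \<open>!W\<close>: the identity of
  \<open>W\<close> is \<open>w\<close> followed by \<epsilon>, and
  \<open>\<e> A \<otimes> \<e> B\<close> is \<open>w\<close> followed by
  \<open>\<e>\<close>.\<close>

lemma tensor_dupl_eras:
  assumes [simp]: "A \<in> Obj X" "B \<in> Obj X"
  shows "tensor_dupl A B \<cdot> (\<one> (!\<^sub>o A \<otimes>\<^sub>o !\<^sub>o B) \<otimes> \<e> A \<otimes> \<e> B) = \<one> (!\<^sub>o A \<otimes>\<^sub>o !\<^sub>o B)"
proof -
  let ?W = "!\<^sub>o A \<otimes>\<^sub>o !\<^sub>o B"
  have "tensor_dupl A B \<cdot> (\<one> ?W \<otimes> (\<e> A \<otimes> \<e> B)) =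
      tensor_dupl A B \<cdot> (tensor_comult A B \<otimes> tensor_comult A B) \<cdot> (\<epsilon> ?W \<otimes> \<e> ?W)"
    by (simp add: interchange tensor_comult_counit tensor_comult_eras)
  also have "\<dots> = tensor_comult A B \<cdot> \<Delta> ?W \<cdot> ((\<one> (!\<^sub>o ?W) \<otimes> \<e> ?W) \<cdot> \<epsilon> ?W)"
    using interchange[of "\<one> (!\<^sub>o ?W)" "\<e> ?W" "\<epsilon> ?W" "\<one> \<K>"]
    by (simp add: tensor_comult_dupl[symmetric])
  also have "\<dots> = \<one> ?W"
    by (simp add: rewrite_head[OF dupl_eras_right] tensor_comult_counit)
  finally show ?thesis by simp
qed

text \<open>Erasing just the second copy of \<open>!B\<close> leaves a duplication of
  \<open>!A\<close> alone, the prefix that occurs in the monoidal rule.\<close>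

lemma tensor_dupl_eras_snd:
  assumes [simp]: "A \<in> Obj X" "B \<in> Obj X"
  shows "tensor_dupl A B \<cdot> (\<one> (!\<^sub>o A \<otimes>\<^sub>o !\<^sub>o B) \<otimes> \<one> (!\<^sub>o A) \<otimes> \<e> B) =
    (\<Delta> A \<otimes> \<one> (!\<^sub>o B)) \<cdot> (\<one> (!\<^sub>o A) \<otimes> \<sigma> (!\<^sub>o A) (!\<^sub>o B))"
proof -
  let ?A = "!\<^sub>o A" and ?B = "!\<^sub>o B"
  have "tensor_dupl A B \<cdot> (\<one> (?A \<otimes>\<^sub>o ?B) \<otimes> \<one> ?A \<otimes> \<e> B) =
      (\<Delta> A \<otimes> \<Delta> B) \<cdot> ((\<one> ?A \<otimes> \<one> ?A) \<otimes> (\<one> ?B \<otimes> \<e> B)) \<cdot> (\<one> ?A \<otimes> \<sigma> ?A ?B)"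
    using middle_exchange_nat[of "\<one> ?A" "\<one> ?A" "\<one> ?B" "\<e> B"]
    by (simp add: tensor_dupl_def)
  also have "\<dots> = (\<Delta> A \<otimes> \<one> ?B) \<cdot> (\<one> ?A \<otimes> \<sigma> ?A ?B)"
    using interchange[of "\<Delta> A" "\<Delta> B" "\<one> ?A \<otimes> \<one> ?A" "\<one> ?B \<otimes> \<e> B"]
    by (simp add: dupl_eras_right)
  finally show ?thesis .
qed

text \<open>Each leg receives \<delta> followed by \<open>!\<^sub>m (\<epsilon> A)\<close>, an
  identity; naturality of \<open>m\<^sub>\<otimes>\<close> and \<open>comult_bang_dupl\<close> then
  gather the result under one \<open>!\<close>. A composite starting with \<delta> is what the chain
  rule can process.\<close>

lemma dupl_mtens:
  assumes [simp]: "A \<in> Obj X"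
  shows "\<Delta> A \<cdot> m\<^sub>\<otimes> A A = \<delta> A \<cdot> !\<^sub>m (\<Delta> A \<cdot> (\<epsilon> A \<otimes> \<epsilon> A))"
proof -
  have "\<Delta> A \<cdot> m\<^sub>\<otimes> A A = \<Delta> A \<cdot> (\<delta> A \<otimes> \<delta> A) \<cdot> ((!\<^sub>m (\<epsilon> A) \<otimes> !\<^sub>m (\<epsilon> A)) \<cdot> m\<^sub>\<otimes> A A)"
    by (simp add: interchange_head comult_bang_counit)
  also have "\<dots> = (\<delta> A \<cdot> !\<^sub>m (\<Delta> A)) \<cdot> !\<^sub>m (\<epsilon> A \<otimes> \<epsilon> A)"
    by (simp add: comult_bang_dupl mtens_nat)
  also have "\<dots> = \<delta> A \<cdot> !\<^sub>m (\<Delta> A \<cdot> (\<epsilon> A \<otimes> \<epsilon> A))"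
    by (simp add: bang_comp_arr)
  finally show ?thesis .
qed

end

section \<open>The induced bialgebra modality\<close>

context additive_linear_category
begin

text \<open>The map lifted along \<open>w\<close> to give \<open>\<nabla>\<close>; in terms of the
  projections of \<open>!A \<otimes> !A\<close> it is \<open>f + g\<close>.\<close>

definition cosum :: "'o \<Rightarrow> 'm"
  where "cosum A = \<epsilon> A \<otimes> \<e> A \<oplus> \<e> A \<otimes> \<epsilon> A"

lemma cosum_arr [simp]:
  assumes "A \<in> Obj X"
  shows "cosum A \<in> Arr X" "src X (cosum A) = !\<^sub>o A \<otimes>\<^sub>o !\<^sub>o A" "trg X (cosum A) = A"
  using assms by (auto simp: cosum_def)

lemma ind_mult_eq:
  assumes [simp]: "A \<in> Obj X"
  shows "\<nabla> A = tensor_comult A A \<cdot> !\<^sub>m (cosum A)"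
  by (simp add: ind_mult_def tensor_comult_def cosum_def)

lemma ind_arr [simp]:
  assumes "A \<in> Obj X"
  shows "\<nabla> A \<in> Arr X" "src X (\<nabla> A) = !\<^sub>o A \<otimes>\<^sub>o !\<^sub>o A" "trg X (\<nabla> A) = !\<^sub>o A"
    "\<u> A \<in> Arr X" "src X (\<u> A) = \<K>" "trg X (\<u> A) = !\<^sub>o A"
  using assms by (auto simp: ind_mult_eq ind_unit_def)

lemma ind_mult_nat:
  assumes [simp]: "f \<in> Arr X" "src X f = A" "trg X f = B"
  shows "(!\<^sub>m f \<otimes> !\<^sub>m f) \<cdot> \<nabla> B = \<nabla> A \<cdot> !\<^sub>m f"
proof -
  have [simp]: "A \<in> Obj X" "B \<in> Obj X" using assms arr_obj by blast+
  \<comment> \<open>Since \<open>\<e>\<close> lands in \<open>\<K>\<close>, a map after \<epsilon>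
    \<otimes> \<open>\<e>\<close> is read as its tensor with \<open>\<one> \<K>\<close>.\<close>
  have p: "(!\<^sub>m f \<otimes> !\<^sub>m f) \<cdot> cosum B = cosum A \<cdot> f"
    by (simp add: cosum_def comp_distrib_left comp_distrib_right interchange counit_nat eras_nat)
      (use interchange[of "\<epsilon> A" "\<e> A" f "\<one> \<K>"] interchange[of "\<e> A" "\<epsilon> A" "\<one> \<K>" f] in simp)
  have "(!\<^sub>m f \<otimes> !\<^sub>m f) \<cdot> \<nabla> B =
      (\<delta> A \<otimes> \<delta> A) \<cdot> ((!\<^sub>m !\<^sub>m f \<otimes> !\<^sub>m !\<^sub>m f) \<cdot> m\<^sub>\<otimes> (!\<^sub>o B) (!\<^sub>o B)) \<cdot> !\<^sub>m (cosum B)"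
    by (simp add: ind_mult_eq tensor_comult_def interchange_head comult_nat)
  also have "\<dots> = tensor_comult A A \<cdot> !\<^sub>m ((!\<^sub>m f \<otimes> !\<^sub>m f) \<cdot> cosum B)"
    by (simp add: mtens_nat bang_comp_arr tensor_comult_def)
  also have "\<dots> = \<nabla> A \<cdot> !\<^sub>m f"
    unfolding p by (simp add: ind_mult_eq bang_comp_arr)
  finally show ?thesis .
qed

text \<open>Any map of the form \<open>w \<cdot> !\<^sub>m h\<close> is a coalgebra morphism, by
  naturality of \<delta> and \<open>tensor_comult_comult\<close>; here \<open>h\<close> is
  \<open>cosum A\<close>.\<close>

lemma ind_mult_comult:
  assumes [simp]: "A \<in> Obj X"
  shows "\<nabla> A \<cdot> \<delta> A = tensor_comult A A \<cdot> !\<^sub>m (\<nabla> A)"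
  by (simp add: ind_mult_eq comult_nat bang_comp_arr rewrite_head[OF tensor_comult_comult])

lemma ind_mult_counit:
  assumes [simp]: "A \<in> Obj X"
  shows "\<nabla> A \<cdot> \<epsilon> A = cosum A"
  by (simp add: ind_mult_eq counit_nat rewrite_head[OF tensor_comult_counit])

lemma ind_mult_eras:
  assumes [simp]: "A \<in> Obj X"
  shows "\<nabla> A \<cdot> \<e> A = \<e> A \<otimes> \<e> A"
  by (simp add: ind_mult_eq eras_nat tensor_comult_eras)

lemma ind_mult_dupl:
  assumes [simp]: "A \<in> Obj X"
  shows "\<nabla> A \<cdot> \<Delta> A = tensor_dupl A A \<cdot> (\<nabla> A \<otimes> \<nabla> A)"
  by (simp add: ind_mult_eq dupl_nat rewrite_head[OF tensor_comult_dupl] interchange)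

text \<open>As \<open>\<nabla>\<close> is a coalgebra morphism, the inner \<open>\<nabla>\<close>
  moves under the \<open>!\<close> of the outer one. Both bracketings thereby become lifts of the
  same threefold sum.\<close>

lemma ind_mult_mult:
  assumes [simp]: "A \<in> Obj X"
  shows "(\<nabla> A \<otimes> \<one> (!\<^sub>o A)) \<cdot> \<nabla> A =
      (tensor_comult A A \<otimes> \<delta> A) \<cdot> m\<^sub>\<otimes> (!\<^sub>o A \<otimes>\<^sub>o !\<^sub>o A) (!\<^sub>o A) \<cdot>
      !\<^sub>m (\<epsilon> A \<otimes> \<e> A \<otimes> \<e> A \<oplus> \<e> A \<otimes> \<epsilon> A \<otimes> \<e> A \<oplus> \<e> A \<otimes> \<e> A \<otimes> \<epsilon> A)" (is "?l = _ \<cdot> !\<^sub>m ?p")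
  and "(\<one> (!\<^sub>o A) \<otimes> \<nabla> A) \<cdot> \<nabla> A =
      (\<delta> A \<otimes> tensor_comult A A) \<cdot> m\<^sub>\<otimes> (!\<^sub>o A) (!\<^sub>o A \<otimes>\<^sub>o !\<^sub>o A) \<cdot>
      !\<^sub>m (\<epsilon> A \<otimes> \<e> A \<otimes> \<e> A \<oplus> \<e> A \<otimes> \<epsilon> A \<otimes> \<e> A \<oplus> \<e> A \<otimes> \<e> A \<otimes> \<epsilon> A)" (is "?r = _ \<cdot> !\<^sub>m ?p")
proof -
  let ?A = "!\<^sub>o A"
  have l: "(\<nabla> A \<otimes> \<one> ?A) \<cdot> cosum A = ?p"
  proof -
    have "(\<nabla> A \<otimes> \<one> ?A) \<cdot> cosum A = cosum A \<otimes> \<e> A \<oplus> (\<e> A \<otimes> \<e> A) \<otimes> \<epsilon> A"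
      by (subst (1) cosum_def)
        (simp add: comp_distrib_left interchange ind_mult_counit ind_mult_eras del: tensor_assoc)
    then show ?thesis
      by (simp add: cosum_def tensor_distrib_right)
  qed
  have r: "(\<one> ?A \<otimes> \<nabla> A) \<cdot> cosum A = ?p"
  proof -
    have "(\<one> ?A \<otimes> \<nabla> A) \<cdot> cosum A = \<epsilon> A \<otimes> (\<e> A \<otimes> \<e> A) \<oplus> \<e> A \<otimes> cosum A"
      by (subst (1) cosum_def)
        (simp add: comp_distrib_left interchange ind_mult_counit ind_mult_eras)
    then show ?thesis
      by (simp add: cosum_def tensor_distrib_left plus_assoc_arr)
  qed
  \<comment> \<open>Used at the second occurrence only, so that the inner \<open>\<nabla>\<close>
    stays folded for \<open>ind_mult_comult\<close>.\<close>
  have n: "\<nabla> A = (\<delta> A \<otimes> \<delta> A) \<cdot> (m\<^sub>\<otimes> ?A ?A \<cdot> !\<^sub>m (cosum A))"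
    by (simp add: ind_mult_eq tensor_comult_def)
  have "?l = ((\<nabla> A \<cdot> \<delta> A) \<otimes> \<delta> A) \<cdot> m\<^sub>\<otimes> ?A ?A \<cdot> !\<^sub>m (cosum A)"
    by (subst (2) n) (simp add: interchange_head)
  \<comment> \<open>The identity is written as \<open>!\<close> of an identity so that naturality of
    \<open>m\<^sub>\<otimes>\<close> applies.\<close>
  also have "\<dots> = (tensor_comult A A \<otimes> \<delta> A) \<cdot> ((!\<^sub>m (\<nabla> A) \<otimes> !\<^sub>m (\<one> ?A)) \<cdot> m\<^sub>\<otimes> ?A ?A) \<cdot> !\<^sub>m (cosum A)"
    by (simp add: interchange_head ind_mult_comult)
  also have "\<dots> = (tensor_comult A A \<otimes> \<delta> A) \<cdot> m\<^sub>\<otimes> (?A \<otimes>\<^sub>o ?A) ?A \<cdot> !\<^sub>m ((\<nabla> A \<otimes> \<one> ?A) \<cdot> cosum A)"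
    by (simp add: mtens_nat bang_comp_arr del: bang_ident)
  finally show "?l = (tensor_comult A A \<otimes> \<delta> A) \<cdot> m\<^sub>\<otimes> (?A \<otimes>\<^sub>o ?A) ?A \<cdot> !\<^sub>m ?p"
    unfolding l .
  have "?r = (\<delta> A \<otimes> (\<nabla> A \<cdot> \<delta> A)) \<cdot> m\<^sub>\<otimes> ?A ?A \<cdot> !\<^sub>m (cosum A)"
    by (subst (2) n) (simp add: interchange_head)
  also have "\<dots> = (\<delta> A \<otimes> tensor_comult A A) \<cdot> ((!\<^sub>m (\<one> ?A) \<otimes> !\<^sub>m (\<nabla> A)) \<cdot> m\<^sub>\<otimes> ?A ?A) \<cdot> !\<^sub>m (cosum A)"
    by (simp add: interchange_head ind_mult_comult)
  also have "\<dots> = (\<delta> A \<otimes> tensor_comult A A) \<cdot> m\<^sub>\<otimes> ?A (?A \<otimes>\<^sub>o ?A) \<cdot> !\<^sub>m ((\<one> ?A \<otimes> \<nabla> A) \<cdot> cosum A)"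
    by (simp add: mtens_nat bang_comp_arr del: bang_ident)
  finally show "?r = (\<delta> A \<otimes> tensor_comult A A) \<cdot> m\<^sub>\<otimes> ?A (?A \<otimes>\<^sub>o ?A) \<cdot> !\<^sub>m ?p"
    unfolding r .
qed

text \<open>By \<open>ind_mult_mult\<close> the two sides end in the same lifted sum, and their
  prefixes agree by associativity of \<open>m\<^sub>\<otimes>\<close>.\<close>

lemma ind_mult_assoc:
  assumes [simp]: "A \<in> Obj X"
  shows "(\<nabla> A \<otimes> \<one> (!\<^sub>o A)) \<cdot> \<nabla> A = (\<one> (!\<^sub>o A) \<otimes> \<nabla> A) \<cdot> \<nabla> A"
proof -
  let ?A = "!\<^sub>o A"
  have "(tensor_comult A A \<otimes> \<delta> A) \<cdot> m\<^sub>\<otimes> (?A \<otimes>\<^sub>o ?A) ?A =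
      (\<delta> A \<otimes> \<delta> A \<otimes> \<delta> A) \<cdot> ((m\<^sub>\<otimes> ?A ?A \<otimes> \<one> (!\<^sub>o ?A)) \<cdot> m\<^sub>\<otimes> (?A \<otimes>\<^sub>o ?A) ?A)"
    using interchange_head[of "\<delta> A \<otimes> \<delta> A" "\<delta> A" "m\<^sub>\<otimes> ?A ?A" "\<one> (!\<^sub>o ?A)"]
    by (simp add: tensor_comult_def)
  also have "\<dots> = (\<delta> A \<otimes> tensor_comult A A) \<cdot> m\<^sub>\<otimes> ?A (?A \<otimes>\<^sub>o ?A)"
    using interchange_head[of "\<delta> A" "\<delta> A \<otimes> \<delta> A" "\<one> (!\<^sub>o ?A)" "m\<^sub>\<otimes> ?A ?A"]
    by (simp add: tensor_comult_def mtens_assoc)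
  finally have "(tensor_comult A A \<otimes> \<delta> A) \<cdot> m\<^sub>\<otimes> (?A \<otimes>\<^sub>o ?A) ?A =
      (\<delta> A \<otimes> tensor_comult A A) \<cdot> m\<^sub>\<otimes> ?A (?A \<otimes>\<^sub>o ?A)" .
  from rewrite_head[OF this] show ?thesis
    by (simp add: ind_mult_mult)
qed

section \<open>Unit and commutativity laws, and additivity of the induced bialgebra modality\<close>

lemma ind_unit_nat: "\<lbrakk>f \<in> Arr X; src X f = A; trg X f = B\<rbrakk> \<Longrightarrow> \<u> A \<cdot> !\<^sub>m f = \<u> B"
  using arr_obj[of f] bang_comp_arr[of "\<zero> \<K> A" f] by (auto simp: ind_unit_def)

lemma ind_unit_comult:
  assumes [simp]: "A \<in> Obj X"
  shows "\<u> A \<cdot> \<delta> A = m\<^sub>\<K> \<cdot> !\<^sub>m (\<u> A)"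
  by (simp add: ind_unit_def comult_nat bang_comp_arr rewrite_head[OF munit_comult])

lemma ind_unit_counit:
  assumes [simp]: "A \<in> Obj X"
  shows "\<u> A \<cdot> \<epsilon> A = \<zero> \<K> A"
  by (simp add: ind_unit_def counit_nat)

lemma ind_unit_eras:
  assumes [simp]: "A \<in> Obj X"
  shows "\<u> A \<cdot> \<e> A = \<one> \<K>"
  by (simp add: ind_unit_def eras_nat munit_eras)

lemma ind_unit_dupl:
  assumes [simp]: "A \<in> Obj X"
  shows "\<u> A \<cdot> \<Delta> A = \<u> A \<otimes> \<u> A"
  by (simp add: ind_unit_def dupl_nat rewrite_head[OF munit_dupl] interchange)

text \<open>Precomposing \<open>cosum\<close> with \<open>\<u>\<close> kills one summand and leaves
  \<epsilon>. Since \<open>\<u>\<close> is a coalgebra morphism it moves under \<open>!\<close>, and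
  the unit law of \<open>m\<^sub>\<otimes>\<close> with \<open>comult_bang_counit\<close>
  finishes.\<close>

lemma ind_unit_mult:
  assumes [simp]: "A \<in> Obj X"
  shows "(\<u> A \<otimes> \<one> (!\<^sub>o A)) \<cdot> \<nabla> A = \<one> (!\<^sub>o A)"
proof -
  let ?A = "!\<^sub>o A"
  have p: "(\<u> A \<otimes> \<one> ?A) \<cdot> cosum A = \<epsilon> A"
    by (simp add: cosum_def comp_distrib_left interchange ind_unit_counit ind_unit_eras)
  have "(\<u> A \<otimes> \<one> ?A) \<cdot> \<nabla> A = ((m\<^sub>\<K> \<cdot> !\<^sub>m (\<u> A)) \<otimes> \<delta> A) \<cdot> m\<^sub>\<otimes> ?A ?A \<cdot> !\<^sub>m (cosum A)"
    by (simp add: ind_mult_eq tensor_comult_def interchange_head ind_unit_comult)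
  also have "\<dots> = (m\<^sub>\<K> \<otimes> \<delta> A) \<cdot> ((!\<^sub>m (\<u> A) \<otimes> !\<^sub>m (\<one> ?A)) \<cdot> m\<^sub>\<otimes> ?A ?A) \<cdot> !\<^sub>m (cosum A)"
    by (simp add: interchange_head)
  also have "\<dots> = (m\<^sub>\<K> \<otimes> \<delta> A) \<cdot> m\<^sub>\<otimes> \<K> ?A \<cdot> !\<^sub>m ((\<u> A \<otimes> \<one> ?A) \<cdot> cosum A)"
    by (simp add: mtens_nat bang_comp_arr del: bang_ident)
  also have "\<dots> = \<delta> A \<cdot> ((m\<^sub>\<K> \<otimes> \<one> (!\<^sub>o ?A)) \<cdot> m\<^sub>\<otimes> \<K> ?A) \<cdot> !\<^sub>m (\<epsilon> A)"
    using interchange_head[of "\<one> \<K>" "\<delta> A" "m\<^sub>\<K>" "\<one> (!\<^sub>o ?A)" "m\<^sub>\<otimes> \<K> ?A \<cdot> !\<^sub>m (\<epsilon> A)"]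
    by (simp add: p)
  also have "\<dots> = \<one> ?A"
    by (simp add: munit_left comult_bang_counit)
  finally show ?thesis .
qed

lemma ind_mult_commute:
  assumes [simp]: "A \<in> Obj X"
  shows "\<sigma> (!\<^sub>o A) (!\<^sub>o A) \<cdot> \<nabla> A = \<nabla> A"
proof -
  let ?A = "!\<^sub>o A"
  have p: "\<sigma> ?A ?A \<cdot> cosum A = cosum A"
    using symm_nat[of "\<epsilon> A" "\<e> A" ?A ?A A \<K>] symm_nat[of "\<e> A" "\<epsilon> A" ?A ?A \<K> A]
    by (simp add: cosum_def comp_distrib_left plus_comm)
  have "\<sigma> ?A ?A \<cdot> \<nabla> A = (\<delta> A \<otimes> \<delta> A) \<cdot> (\<sigma> (!\<^sub>o ?A) (!\<^sub>o ?A) \<cdot> m\<^sub>\<otimes> ?A ?A) \<cdot> !\<^sub>m (cosum A)"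
    by (simp add: ind_mult_eq tensor_comult_def rewrite_head[OF symm_nat[symmetric]])
  also have "\<dots> = tensor_comult A A \<cdot> !\<^sub>m (\<sigma> ?A ?A \<cdot> cosum A)"
    by (simp add: mtens_symm bang_comp_arr tensor_comult_def)
  finally show ?thesis
    by (simp add: p ind_mult_eq)
qed

lemma ind_mult_unit:
  assumes [simp]: "A \<in> Obj X"
  shows "(\<one> (!\<^sub>o A) \<otimes> \<u> A) \<cdot> \<nabla> A = \<one> (!\<^sub>o A)"
proof -
  have "(\<one> (!\<^sub>o A) \<otimes> \<u> A) \<cdot> \<nabla> A = ((\<one> (!\<^sub>o A) \<otimes> \<u> A) \<cdot> \<sigma> (!\<^sub>o A) (!\<^sub>o A)) \<cdot> \<nabla> A"
    by (simp add: ind_mult_commute)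
  also have "\<dots> = \<one> (!\<^sub>o A)"
    by (subst symm_nat[of _ _ "!\<^sub>o A" \<K>]) (simp_all add: ind_unit_mult)
  finally show ?thesis .
qed

lemma bialgebra_modality_ind: "bialgebra_modality X \<nabla> \<u>"
proof unfold_locales
  fix A assume [simp]: "A \<in> Obj X"
  show "\<guillemotleft>\<nabla> A : !\<^sub>o A \<otimes>\<^sub>o !\<^sub>o A \<rightarrow> !\<^sub>o A\<guillemotright>" "\<guillemotleft>\<u> A : \<K> \<rightarrow> !\<^sub>o A\<guillemotright>"
    by (simp_all add: in_hom_def)
qed (simp_all add: ind_mult_assoc ind_unit_mult ind_mult_unit ind_mult_commute ind_mult_eras ind_unit_dupl
    ind_unit_eras ind_mult_dupl tensor_dupl_def ind_mult_counit cosum_def,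
    auto simp: in_hom_def ind_mult_nat ind_unit_nat)

text \<open>As \<Delta> is a coalgebra morphism, the left side is \<delta> followed by
  \<open>!\<close> of a map out of \<open>!\<^sub>o A\<close>. That map is \<epsilon> followed by
  the sum, and \<delta> cancels its \<epsilon>.\<close>

lemma bang_plus:
  assumes [simp]: "f \<in> Arr X" "g \<in> Arr X" "src X f = A" "src X g = A" "trg X f = B" "trg X g = B"
  shows "\<Delta> A \<cdot> (!\<^sub>m f \<otimes> !\<^sub>m g) \<cdot> \<nabla> B = !\<^sub>m (f \<oplus> g)"
proof -
  have [simp]: "A \<in> Obj X" "B \<in> Obj X" using assms arr_obj by blast+
  \<comment> \<open>In each summand one of the two copies is erased, so a counit law removes the
    duplication.\<close>
  have "\<Delta> A \<cdot> ((!\<^sub>m f \<otimes> !\<^sub>m g) \<cdot> cosum B) =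
     (\<Delta> A \<cdot> (\<one> (!\<^sub>o A) \<otimes> \<e> A)) \<cdot> (\<epsilon> A \<cdot> f) \<oplus> (\<Delta> A \<cdot> (\<e> A \<otimes> \<one> (!\<^sub>o A))) \<cdot> (\<epsilon> A \<cdot> g)"
    using interchange[of "\<one> (!\<^sub>o A)" "\<e> A" "\<epsilon> A \<cdot> f" "\<one> \<K>"]
      interchange[of "\<e> A" "\<one> (!\<^sub>o A)" "\<one> \<K>" "\<epsilon> A \<cdot> g"]
    by (simp add: cosum_def comp_distrib_left interchange counit_nat eras_nat)
  then have p: "\<Delta> A \<cdot> ((!\<^sub>m f \<otimes> !\<^sub>m g) \<cdot> cosum B) = \<epsilon> A \<cdot> (f \<oplus> g)"
    by (simp only: dupl_eras_left dupl_eras_right \<open>A \<in> Obj X\<close>) (simp add: comp_distrib_left)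
  have "\<Delta> A \<cdot> (!\<^sub>m f \<otimes> !\<^sub>m g) \<cdot> \<nabla> B =
     \<Delta> A \<cdot> (\<delta> A \<otimes> \<delta> A) \<cdot> ((!\<^sub>m !\<^sub>m f \<otimes> !\<^sub>m !\<^sub>m g) \<cdot> m\<^sub>\<otimes> (!\<^sub>o B) (!\<^sub>o B)) \<cdot> !\<^sub>m (cosum B)"
    by (simp add: ind_mult_eq tensor_comult_def interchange_head comult_nat)
  also have "\<dots> = (\<Delta> A \<cdot> (\<delta> A \<otimes> \<delta> A) \<cdot> m\<^sub>\<otimes> (!\<^sub>o A) (!\<^sub>o A)) \<cdot> !\<^sub>m ((!\<^sub>m f \<otimes> !\<^sub>m g) \<cdot> cosum B)"
    by (simp add: mtens_nat bang_comp_arr)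
  also have "\<dots> = \<delta> A \<cdot> !\<^sub>m (\<Delta> A \<cdot> ((!\<^sub>m f \<otimes> !\<^sub>m g) \<cdot> cosum B))"
    by (subst comult_bang_dupl[symmetric]) (simp_all add: bang_comp_arr)
  also have "\<dots> = !\<^sub>m (f \<oplus> g)"
    unfolding p by (simp add: bang_comp_arr rewrite_head[OF comult_bang_counit])
  finally show ?thesis .
qed

end

section \<open>Partial derivatives\<close>

locale linear_deriving = additive_linear_category X + deriving_transformation X d
  for X :: "('o, 'm, 'z) mon_coalg_mod_scheme" (structure) and d :: "'o \<Rightarrow> 'm"
begin

lemma d_arr [simp]:
  assumes "A \<in> Obj X"
  shows "d A \<in> Arr X" "src X (d A) = !\<^sub>o A \<otimes>\<^sub>o A" "trg X (d A) = !\<^sub>o A"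
  using d_hom[of A] assms by (auto simp: in_hom_def)

lemma d_nat:
  "\<lbrakk>f \<in> Arr X; src X f = A; trg X f = B\<rbrakk> \<Longrightarrow> (!\<^sub>m f \<otimes> f) \<cdot> d B = d A \<cdot> !\<^sub>m f"
  using d_natural[of f A B] by (auto simp: in_hom_def)

text \<open>The derivative in the second variable, as a point of \<open>!(!A \<otimes> !B)\<close> together with a direction in
  \<open>!A \<otimes> !B\<close>.\<close>

definition tangent :: "'o \<Rightarrow> 'o \<Rightarrow> 'm"
  where "tangent A B =
    (tensor_dupl A B \<otimes> \<one> B) \<cdot> (tensor_comult A B \<otimes> \<one> (!\<^sub>o A) \<otimes> d B)"

lemma tangent_arr [simp]:
  assumes "A \<in> Obj X" "B \<in> Obj X"
  shows "tangent A B \<in> Arr X" "src X (tangent A B) = !\<^sub>o A \<otimes>\<^sub>o !\<^sub>o B \<otimes>\<^sub>o B"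
    "trg X (tangent A B) = !\<^sub>o (!\<^sub>o A \<otimes>\<^sub>o !\<^sub>o B) \<otimes>\<^sub>o !\<^sub>o A \<otimes>\<^sub>o !\<^sub>o B"
  using assms by (auto simp: tangent_def)

lemma tangent_comp:
  assumes [simp]: "A \<in> Obj X" "B \<in> Obj X" "f \<in> Arr X" "g \<in> Arr X"
    "src X f = !\<^sub>o (!\<^sub>o A \<otimes>\<^sub>o !\<^sub>o B)" "src X g = !\<^sub>o A \<otimes>\<^sub>o !\<^sub>o B"
  shows "tangent A B \<cdot> (f \<otimes> g) =
    (tensor_dupl A B \<otimes> \<one> B) \<cdot> ((tensor_comult A B \<cdot> f) \<otimes> ((\<one> (!\<^sub>o A) \<otimes> d B) \<cdot> g))"
  using interchange[of "tensor_comult A B" "\<one> (!\<^sub>o A) \<otimes> d B" f g] by (simp add: tangent_def)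

text \<open>Coassociativity of \<open>c\<close> lets the extra copy of the point be made first. This
  is the shape needed for the chain rule, whose inner derivative then again acts on a
  tangent.\<close>

lemma tangent_dupl:
  assumes [simp]: "A \<in> Obj X" "B \<in> Obj X"
  defines "W \<equiv> !\<^sub>o A \<otimes>\<^sub>o !\<^sub>o B"
  shows "tangent A B \<cdot> (\<Delta> W \<otimes> \<one> W) = (tensor_dupl A B \<otimes> \<one> B) \<cdot> (tensor_comult A B \<otimes> tangent A B)"
proof -
  let ?c = "tensor_dupl A B" and ?w = "tensor_comult A B" and ?D = "\<one> (!\<^sub>o A) \<otimes> d B"
  have [simp]: "W \<in> Obj X" "src X ?w = W" "trg X ?w = !\<^sub>o W" "src X ?c = W" "trg X ?c = W \<otimes>\<^sub>o W"
    "src X ?D = W \<otimes>\<^sub>o B" "trg X ?D = W" "?D \<in> Arr X"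
    by (simp_all add: W_def)
  have "tangent A B \<cdot> (\<Delta> W \<otimes> \<one> W) = (?c \<otimes> \<one> B) \<cdot> ((?w \<cdot> \<Delta> W) \<otimes> (?D \<cdot> \<one> W))"
    using tangent_comp[of A B "\<Delta> W" "\<one> W"] by (simp add: W_def)
  also have "?w \<cdot> \<Delta> W = ?c \<cdot> (?w \<otimes> ?w)"
    by (simp add: W_def tensor_comult_dupl)
  \<comment> \<open>Regrouping makes the two duplications adjacent, ready for
    \<open>tensor_dupl_assoc\<close>.\<close>
  also have "(?c \<otimes> \<one> B) \<cdot> ((?c \<cdot> (?w \<otimes> ?w)) \<otimes> (?D \<cdot> \<one> W)) =
      ((?c \<cdot> (?c \<otimes> \<one> W)) \<otimes> \<one> B) \<cdot> ((?w \<otimes> ?w) \<otimes> ?D)"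
    using interchange[of "?c \<otimes> \<one> W" "\<one> B" "?w \<otimes> ?w" ?D]
      interchange[of ?c "\<one> (W \<otimes>\<^sub>o B)" "?w \<otimes> ?w" ?D]
      interchange[of ?c "\<one> B" "?c \<otimes> \<one> W" "\<one> B"]
      rewrite_head[OF interchange, of ?c "\<one> B" "?c \<otimes> \<one> W" "\<one> B" "?w \<otimes> ?w \<otimes> ?D"]
    by (simp del: ident_tensor_ident_tensor)
  also have "?c \<cdot> (?c \<otimes> \<one> W) = ?c \<cdot> (\<one> W \<otimes> ?c)"
    using tensor_dupl_assoc[of A B] by (simp add: W_def)
  also have "((?c \<cdot> (\<one> W \<otimes> ?c)) \<otimes> \<one> B) \<cdot> ((?w \<otimes> ?w) \<otimes> ?D) =
      ((?c \<otimes> \<one> B) \<cdot> (\<one> W \<otimes> ?c \<otimes> \<one> B)) \<cdot> (?w \<otimes> (?w \<otimes> ?D))"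
    using interchange[of ?c "\<one> B" "\<one> W \<otimes> ?c" "\<one> B"] by simp
  also have "\<dots> = (?c \<otimes> \<one> B) \<cdot> (?w \<otimes> tangent A B)"
    using interchange[of "\<one> W" "?c \<otimes> \<one> B" ?w "?w \<otimes> ?D"] by (simp add: tangent_def)
  finally show ?thesis .
qed

text \<open>The projections undo \<open>w\<close> and the duplication by
  \<open>tensor_comult_dupl_fst_snd\<close>, leaving the point itself. The direction map
  \<open>k\<close> is arbitrary because the product rule calls for both projections.\<close>

lemma tangent_dupl_split:
  assumes [simp]: "A \<in> Obj X" "B \<in> Obj X" "k \<in> Arr X" "src X k = !\<^sub>o A \<otimes>\<^sub>o !\<^sub>o B"
  defines "W \<equiv> !\<^sub>o A \<otimes>\<^sub>o !\<^sub>o B"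
  shows "tangent A B \<cdot> (\<Delta> W \<otimes> \<one> W) \<cdot> ((!\<^sub>m (\<epsilon> A \<otimes> \<e> B) \<otimes> !\<^sub>m (\<e> A \<otimes> \<epsilon> B)) \<otimes> k) =
    (tensor_dupl A B \<otimes> \<one> B) \<cdot> (\<one> W \<otimes> ((\<one> (!\<^sub>o A) \<otimes> d B) \<cdot> k))"
proof -
  let ?fg = "!\<^sub>m (\<epsilon> A \<otimes> \<e> B) \<otimes> !\<^sub>m (\<e> A \<otimes> \<epsilon> B)"
  have "tangent A B \<cdot> (\<Delta> W \<otimes> \<one> W) \<cdot> (?fg \<otimes> k) = tangent A B \<cdot> ((\<Delta> W \<cdot> ?fg) \<otimes> k)"
    using interchange[of "\<Delta> W" "\<one> W" ?fg k] by (simp add: W_def)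
  also have "\<dots> = (tensor_dupl A B \<otimes> \<one> B) \<cdot>
      ((tensor_comult A B \<cdot> \<Delta> W \<cdot> ?fg) \<otimes> ((\<one> (!\<^sub>o A) \<otimes> d B) \<cdot> k))"
    using tangent_comp[of A B "\<Delta> W \<cdot> ?fg" k] by (simp add: W_def)
  finally show ?thesis
    unfolding W_def by (simp only: tensor_comult_dupl_fst_snd assms)
qed

text \<open>Naturality of \<open>d\<close> and \<sigma> carries \<open>f\<close> and
  \<open>g\<close> to the front of each product-rule summand, so that differentiation takes place at
  \<open>A\<close> or \<open>B\<close> instead of \<open>W\<close>.\<close>

lemma d_dupl_bang:
  assumes [simp]: "f \<in> Arr X" "g \<in> Arr X" "src X f = W" "src X g = W" "trg X f = A" "trg X g = B"
  shows "d W \<cdot> \<Delta> W \<cdot> (!\<^sub>m f \<otimes> !\<^sub>m g) =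
    (\<Delta> W \<otimes> \<one> W) \<cdot>
    (((!\<^sub>m f \<otimes> !\<^sub>m g) \<otimes> g) \<cdot> (\<one> (!\<^sub>o A) \<otimes> d B) \<oplus>
     ((!\<^sub>m f \<otimes> !\<^sub>m g) \<otimes> f) \<cdot> ((\<one> (!\<^sub>o A) \<otimes> \<sigma> (!\<^sub>o B) A) \<cdot> (d A \<otimes> \<one> (!\<^sub>o B))))"
proof -
  have [simp]: "W \<in> Obj X" "A \<in> Obj X" "B \<in> Obj X" using assms arr_obj by blast+
  have g: "(\<one> (!\<^sub>o W) \<otimes> d W) \<cdot> (!\<^sub>m f \<otimes> !\<^sub>m g) = ((!\<^sub>m f \<otimes> !\<^sub>m g) \<otimes> g) \<cdot> (\<one> (!\<^sub>o A) \<otimes> d B)"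
    by (simp add: interchange d_nat)
  have "(\<one> (!\<^sub>o W) \<otimes> \<sigma> (!\<^sub>o W) W) \<cdot> (d W \<otimes> \<one> (!\<^sub>o W)) \<cdot> (!\<^sub>m f \<otimes> !\<^sub>m g) =
      (\<one> (!\<^sub>o W) \<otimes> \<sigma> (!\<^sub>o W) W) \<cdot> (((!\<^sub>m f \<otimes> f) \<cdot> d A) \<otimes> !\<^sub>m g)"
    by (simp add: interchange d_nat)
  also have "\<dots> = ((\<one> (!\<^sub>o W) \<otimes> \<sigma> (!\<^sub>o W) W) \<cdot> (!\<^sub>m f \<otimes> (f \<otimes> !\<^sub>m g))) \<cdot> (d A \<otimes> \<one> (!\<^sub>o B))"
    using interchange[of "!\<^sub>m f \<otimes> f" "!\<^sub>m g" "d A" "\<one> (!\<^sub>o B)"] by simp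
  also have "(\<one> (!\<^sub>o W) \<otimes> \<sigma> (!\<^sub>o W) W) \<cdot> (!\<^sub>m f \<otimes> (f \<otimes> !\<^sub>m g)) =
      ((!\<^sub>m f \<otimes> !\<^sub>m g) \<otimes> f) \<cdot> (\<one> (!\<^sub>o A) \<otimes> \<sigma> (!\<^sub>o B) A)"
    by (simp add: interchange symm_nat)
  finally have f: "(\<one> (!\<^sub>o W) \<otimes> \<sigma> (!\<^sub>o W) W) \<cdot> (d W \<otimes> \<one> (!\<^sub>o W)) \<cdot> (!\<^sub>m f \<otimes> !\<^sub>m g) =
      ((!\<^sub>m f \<otimes> !\<^sub>m g) \<otimes> f) \<cdot> ((\<one> (!\<^sub>o A) \<otimes> \<sigma> (!\<^sub>o B) A) \<cdot> (d A \<otimes> \<one> (!\<^sub>o B)))"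
    by simp
  have "d W \<cdot> \<Delta> W \<cdot> (!\<^sub>m f \<otimes> !\<^sub>m g) = (\<Delta> W \<otimes> \<one> W) \<cdot>
      ((\<one> (!\<^sub>o W) \<otimes> d W) \<cdot> (!\<^sub>m f \<otimes> !\<^sub>m g) \<oplus>
       (\<one> (!\<^sub>o W) \<otimes> \<sigma> (!\<^sub>o W) W) \<cdot> (d W \<otimes> \<one> (!\<^sub>o W)) \<cdot> (!\<^sub>m f \<otimes> !\<^sub>m g))"
    by (simp add: product_rule comp_distrib_right)
  then show ?thesis
    unfolding f g .
qed

text \<open>The first projection does not depend on the second variable, so only one of the two summands
  of the product rule survives.\<close>

lemma tangent_d_dupl_split:
  assumes [simp]: "A \<in> Obj X" "B \<in> Obj X"
  defines "W \<equiv> !\<^sub>o A \<otimes>\<^sub>o !\<^sub>o B"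
  shows "tangent A B \<cdot> d W \<cdot> \<Delta> W \<cdot> (!\<^sub>m (\<epsilon> A \<otimes> \<e> B) \<otimes> !\<^sub>m (\<e> A \<otimes> \<epsilon> B)) = \<one> (!\<^sub>o A) \<otimes> d B"
proof -
  let ?f = "\<epsilon> A \<otimes> \<e> B" and ?g = "\<e> A \<otimes> \<epsilon> B" and ?D = "\<one> (!\<^sub>o A) \<otimes> d B"
  let ?c = "tensor_dupl A B" and ?F = "!\<^sub>m ?f \<otimes> !\<^sub>m ?g" and ?S = "tangent A B \<cdot> (\<Delta> W \<otimes> \<one> W)"
  let ?R = "(\<one> (!\<^sub>o A) \<otimes> \<sigma> (!\<^sub>o B) A) \<cdot> (d A \<otimes> \<one> (!\<^sub>o B))"
  have "?D \<cdot> ?f = \<zero> (W \<otimes>\<^sub>o B) A"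
    by (simp add: W_def interchange constant_rule)
  then have Sf: "?S \<cdot> (?F \<otimes> ?f) = \<zero> (W \<otimes>\<^sub>o B) (W \<otimes>\<^sub>o A)"
    using tangent_dupl_split[of A B ?f] by (simp add: W_def)
  \<comment> \<open>By the linear rule the second projection returns the direction in
    \<open>B\<close> and erases the second copy of \<open>W\<close>, so the counit law for
    \<open>c\<close> makes this prefix an identity.\<close>
  have "?D \<cdot> ?g = \<e> A \<otimes> \<e> B \<otimes> \<one> B"
    by (simp add: interchange linear_rule)
  then have Sg: "?S \<cdot> (?F \<otimes> ?g) = \<one> (W \<otimes>\<^sub>o B)"
    using tangent_dupl_split[of A B ?g] tensor_dupl_eras[of A B]
      interchange[of ?c "\<one> B" "\<one> W \<otimes> \<e> A \<otimes> \<e> B" "\<one> B"] by (simp add: W_def)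
  have "tangent A B \<cdot> d W \<cdot> \<Delta> W \<cdot> ?F = tangent A B \<cdot> (d W \<cdot> \<Delta> W \<cdot> ?F)"
    by (simp add: W_def)
  also have "\<dots> = tangent A B \<cdot> ((\<Delta> W \<otimes> \<one> W) \<cdot> ((?F \<otimes> ?g) \<cdot> ?D \<oplus> (?F \<otimes> ?f) \<cdot> ?R))"
    by (subst d_dupl_bang[of _ _ _ A B]) (simp_all add: W_def)
  also have "\<dots> = (?S \<cdot> (?F \<otimes> ?g)) \<cdot> ?D \<oplus> (?S \<cdot> (?F \<otimes> ?f)) \<cdot> ?R"
    by (simp add: W_def comp_distrib_left)
  also have "\<dots> = ?D"
    unfolding Sf Sg by (simp add: W_def)
  finally show ?thesis .
qed

section \<open>Compatibility of differentiation with \<open>\<nabla>\<close> and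
  \<open>m\<^sub>\<otimes>\<close>\<close>

lemma tangent_d_bang:
  assumes [simp]: "A \<in> Obj X" "B \<in> Obj X" "h \<in> Arr X" "src X h = !\<^sub>o A \<otimes>\<^sub>o !\<^sub>o B" "trg X h = C"
  shows "tangent A B \<cdot> d (!\<^sub>o A \<otimes>\<^sub>o !\<^sub>o B) \<cdot> !\<^sub>m h =
    (tensor_dupl A B \<otimes> \<one> B) \<cdot> ((tensor_comult A B \<cdot> !\<^sub>m h) \<otimes> ((\<one> (!\<^sub>o A) \<otimes> d B) \<cdot> h)) \<cdot> d C"
proof -
  have [simp]: "C \<in> Obj X" using assms arr_obj by blast
  have "tangent A B \<cdot> d (!\<^sub>o A \<otimes>\<^sub>o !\<^sub>o B) \<cdot> !\<^sub>m h = tangent A B \<cdot> (!\<^sub>m h \<otimes> h) \<cdot> d C"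
    by (simp add: d_nat)
  then show ?thesis
    using tangent_comp[of A B "!\<^sub>m h" h] by simp
qed

lemma nabla_rule:
  assumes [simp]: "A \<in> Obj X"
  shows "(\<one> (!\<^sub>o A) \<otimes> d A) \<cdot> \<nabla> A = (\<nabla> A \<otimes> \<one> A) \<cdot> d A"
proof -
  let ?f = "\<epsilon> A \<otimes> \<e> A" and ?g = "\<e> A \<otimes> \<epsilon> A" and ?W = "!\<^sub>o A \<otimes>\<^sub>o !\<^sub>o A"
  let ?c = "tensor_dupl A A"
  have "(\<one> (!\<^sub>o A) \<otimes> d A) \<cdot> \<nabla> A = tangent A A \<cdot> d ?W \<cdot> (\<Delta> ?W \<cdot> (!\<^sub>m ?f \<otimes> !\<^sub>m ?g) \<cdot> \<nabla> A)"
    by (subst tangent_d_dupl_split[symmetric]) simp_all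
  also have "\<dots> = tangent A A \<cdot> d ?W \<cdot> !\<^sub>m (cosum A)"
    by (subst bang_plus) (simp_all add: cosum_def)
  also have "\<dots> = (?c \<otimes> \<one> A) \<cdot> ((tensor_comult A A \<cdot> !\<^sub>m (cosum A)) \<otimes> ((\<one> (!\<^sub>o A) \<otimes> d A) \<cdot> cosum A)) \<cdot> d A"
    by (subst tangent_d_bang[where C = A]) simp_all
  \<comment> \<open>The direction for the derivative at \<open>A\<close>: the constant rule removes
    one summand and the linear rule evaluates the other.\<close>
  also have "(\<one> (!\<^sub>o A) \<otimes> d A) \<cdot> cosum A = \<e> A \<otimes> \<e> A \<otimes> \<one> A"
    by (simp add: cosum_def comp_distrib_left interchange constant_rule linear_rule)
  also have "tensor_comult A A \<cdot> !\<^sub>m (cosum A) = \<nabla> A"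
    by (simp add: ind_mult_eq)
  also have "\<nabla> A \<otimes> \<e> A \<otimes> \<e> A \<otimes> \<one> A = ((\<one> ?W \<otimes> \<e> A \<otimes> \<e> A) \<otimes> \<one> A) \<cdot> (\<nabla> A \<otimes> \<one> A)"
    using interchange[of "\<one> ?W" "\<e> A \<otimes> \<e> A \<otimes> \<one> A" "\<nabla> A" "\<one> A"] by simp
  also have "(?c \<otimes> \<one> A) \<cdot> \<dots> \<cdot> d A =
      ((?c \<cdot> (\<one> ?W \<otimes> \<e> A \<otimes> \<e> A)) \<otimes> \<one> A) \<cdot> (\<nabla> A \<otimes> \<one> A) \<cdot> d A"
    using interchange_head[of ?c "\<one> A" "\<one> ?W \<otimes> \<e> A \<otimes> \<e> A" "\<one> A" "(\<nabla> A \<otimes> \<one> A) \<cdot> d A"]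
    by simp
  also have "\<dots> = (\<nabla> A \<otimes> \<one> A) \<cdot> d A"
    by (simp add: tensor_dupl_eras)
  finally show ?thesis .
qed

theorem monoidal_rule:
  assumes [simp]: "A \<in> Obj X" "B \<in> Obj X"
  shows "(\<one> (!\<^sub>o A) \<otimes> d B) \<cdot> m\<^sub>\<otimes> A B =
            (\<Delta> A \<otimes> \<one> (!\<^sub>o B) \<otimes> \<one> B) \<cdot>
            (\<one> (!\<^sub>o A) \<otimes> \<sigma> (!\<^sub>o A) (!\<^sub>o B) \<otimes> \<one> B) \<cdot>
            (m\<^sub>\<otimes> A B \<otimes> \<epsilon> A \<otimes> \<one> B) \<cdot>
            d (A \<otimes>\<^sub>o B)"
proof -
  define W where "W = !\<^sub>o A \<otimes>\<^sub>o !\<^sub>o B"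
  define f where "f = \<epsilon> A \<otimes> \<e> B"
  define g where "g = \<e> A \<otimes> \<epsilon> B"
  \<comment> \<open>Chosen so that \<open>m\<^sub>\<otimes>\<close> after the paired projections is
    \<delta> followed by \<open>!\<^sub>m q\<close>.\<close>
  define q where "q = \<Delta> W \<cdot> (\<epsilon> W \<otimes> \<epsilon> W) \<cdot> (f \<otimes> g)"
  let ?D = "\<one> (!\<^sub>o A) \<otimes> d B"
  let ?T = "tangent A B" and ?c = "tensor_dupl A B" and ?w = "tensor_comult A B"
  have [simp]: "W \<in> Obj X" "f \<in> Arr X" "g \<in> Arr X"
    "src X f = W" "src X g = W" "trg X f = A" "trg X g = B"
    "src X ?w = W" "trg X ?w = !\<^sub>o W" "src X ?c = W" "trg X ?c = W \<otimes>\<^sub>o W"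
    "src X ?T = W \<otimes>\<^sub>o B" "trg X ?T = !\<^sub>o W \<otimes>\<^sub>o W"
    by (simp_all add: W_def f_def g_def)
  have [simp]: "q \<in> Arr X" "src X q = !\<^sub>o W" "trg X q = A \<otimes>\<^sub>o B"
    by (simp_all add: q_def)
  have split: "?T \<cdot> d W \<cdot> \<Delta> W \<cdot> (!\<^sub>m f \<otimes> !\<^sub>m g) = ?D"
    by (simp only: W_def f_def g_def tangent_d_dupl_split assms)
  have m: "\<Delta> W \<cdot> (!\<^sub>m f \<otimes> !\<^sub>m g) \<cdot> m\<^sub>\<otimes> A B = \<delta> W \<cdot> !\<^sub>m q"
  proof -
    have "\<Delta> W \<cdot> (!\<^sub>m f \<otimes> !\<^sub>m g) \<cdot> m\<^sub>\<otimes> A B = (\<Delta> W \<cdot> m\<^sub>\<otimes> W W) \<cdot> !\<^sub>m (f \<otimes> g)"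
      by (simp add: mtens_nat)
    also have "\<dots> = \<delta> W \<cdot> !\<^sub>m q"
      by (simp add: dupl_mtens q_def bang_comp_arr)
    finally show ?thesis .
  qed
  \<comment> \<open>This is the base point in the chain rule: \<open>w\<close> cancels the paired
    projections, leaving \<open>m\<^sub>\<otimes>\<close>.\<close>
  have "?w \<cdot> \<delta> W \<cdot> !\<^sub>m q = (?w \<cdot> \<Delta> W \<cdot> (!\<^sub>m f \<otimes> !\<^sub>m g)) \<cdot> m\<^sub>\<otimes> A B"
    using m by simp
  also have "?w \<cdot> \<Delta> W \<cdot> (!\<^sub>m f \<otimes> !\<^sub>m g) = \<one> W"
    by (simp only: W_def f_def g_def tensor_comult_dupl_fst_snd assms)
  finally have wq: "?w \<cdot> \<delta> W \<cdot> !\<^sub>m q = m\<^sub>\<otimes> A B"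
    by (simp add: W_def)
  \<comment> \<open>This is the direction in the chain rule: naturality of \<epsilon> makes
    \<open>q\<close> end in \<epsilon> \<otimes> \<epsilon>, so \<open>split\<close> and the linear
    rule evaluate it.\<close>
  have "?T \<cdot> d W \<cdot> q = (?T \<cdot> d W \<cdot> \<Delta> W \<cdot> (!\<^sub>m f \<otimes> !\<^sub>m g)) \<cdot> (\<epsilon> A \<otimes> \<epsilon> B)"
    by (simp add: q_def interchange counit_nat)
  also have "\<dots> = \<epsilon> A \<otimes> \<e> B \<otimes> \<one> B"
    unfolding split by (simp add: interchange linear_rule)
  finally have Tq: "?T \<cdot> d W \<cdot> q = \<epsilon> A \<otimes> \<e> B \<otimes> \<one> B" .
  have S: "?T \<cdot> (\<Delta> W \<otimes> \<one> W) = (?c \<otimes> \<one> B) \<cdot> (?w \<otimes> ?T)"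
    using tangent_dupl[of A B] by (simp add: W_def)
  have "?D \<cdot> m\<^sub>\<otimes> A B = ?T \<cdot> d W \<cdot> (\<Delta> W \<cdot> (!\<^sub>m f \<otimes> !\<^sub>m g) \<cdot> m\<^sub>\<otimes> A B)"
    unfolding split[symmetric] by simp
  also have "\<dots> = ?T \<cdot> (d W \<cdot> \<delta> W) \<cdot> !\<^sub>m q"
    unfolding m by simp
  \<comment> \<open>After the chain rule, naturality of the outer \<open>d\<close> along
    \<open>q\<close> moves it to \<open>A \<otimes>\<^sub>o B\<close>.\<close>
  also have "\<dots> = (?T \<cdot> (\<Delta> W \<otimes> \<one> W)) \<cdot> ((\<delta> W \<otimes> d W) \<cdot> (!\<^sub>m q \<otimes> q)) \<cdot> d (A \<otimes>\<^sub>o B)"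
    by (simp add: chain_rule d_nat)
  also have "\<dots> = (?c \<otimes> \<one> B) \<cdot> ((?w \<cdot> \<delta> W \<cdot> !\<^sub>m q) \<otimes> (?T \<cdot> d W \<cdot> q)) \<cdot> d (A \<otimes>\<^sub>o B)"
    unfolding S by (simp add: interchange_head interchange)
  also have "\<dots> = (?c \<otimes> \<one> B) \<cdot> (m\<^sub>\<otimes> A B \<otimes> (\<epsilon> A \<otimes> \<e> B \<otimes> \<one> B)) \<cdot> d (A \<otimes>\<^sub>o B)"
    unfolding wq Tq ..
  also have "m\<^sub>\<otimes> A B \<otimes> (\<epsilon> A \<otimes> \<e> B \<otimes> \<one> B) =
      ((\<one> W \<otimes> \<one> (!\<^sub>o A) \<otimes> \<e> B) \<otimes> \<one> B) \<cdot> (m\<^sub>\<otimes> A B \<otimes> \<epsilon> A \<otimes> \<one> B)"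
    using interchange[of "\<one> W" "\<one> (!\<^sub>o A) \<otimes> \<e> B \<otimes> \<one> B" "m\<^sub>\<otimes> A B" "\<epsilon> A \<otimes> \<one> B"]
      interchange[of "\<one> (!\<^sub>o A)" "\<e> B \<otimes> \<one> B" "\<epsilon> A" "\<one> B"]
    by (simp add: W_def)
  also have "(?c \<otimes> \<one> B) \<cdot> \<dots> \<cdot> d (A \<otimes>\<^sub>o B) =
      ((?c \<cdot> (\<one> W \<otimes> \<one> (!\<^sub>o A) \<otimes> \<e> B)) \<otimes> \<one> B) \<cdot> (m\<^sub>\<otimes> A B \<otimes> \<epsilon> A \<otimes> \<one> B) \<cdot> d (A \<otimes>\<^sub>o B)"
    using interchange_head[of ?c "\<one> B" "\<one> W \<otimes> \<one> (!\<^sub>o A) \<otimes> \<e> B" "\<one> B"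
        "(m\<^sub>\<otimes> A B \<otimes> \<epsilon> A \<otimes> \<one> B) \<cdot> d (A \<otimes>\<^sub>o B)"]
    by (simp add: W_def)
  also have "?c \<cdot> (\<one> W \<otimes> \<one> (!\<^sub>o A) \<otimes> \<e> B) = (\<Delta> A \<otimes> \<one> (!\<^sub>o B)) \<cdot> (\<one> (!\<^sub>o A) \<otimes> \<sigma> (!\<^sub>o A) (!\<^sub>o B))"
    by (simp only: W_def tensor_dupl_eras_snd assms)
  also have "(((\<Delta> A \<otimes> \<one> (!\<^sub>o B)) \<cdot> (\<one> (!\<^sub>o A) \<otimes> \<sigma> (!\<^sub>o A) (!\<^sub>o B))) \<otimes> \<one> B) =
     (\<Delta> A \<otimes> \<one> (!\<^sub>o B) \<otimes> \<one> B) \<cdot> (\<one> (!\<^sub>o A) \<otimes> \<sigma> (!\<^sub>o A) (!\<^sub>o B) \<otimes> \<one> B)"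
    using interchange[of "\<Delta> A \<otimes> \<one> (!\<^sub>o B)" "\<one> B" "\<one> (!\<^sub>o A) \<otimes> \<sigma> (!\<^sub>o A) (!\<^sub>o B)" "\<one> B"] by simp
  finally show ?thesis .
qed

section \<open>The codereliction as differentiation at zero\<close>

definition coder :: "'o \<Rightarrow> 'm"
  where "coder A = (\<u> A \<otimes> \<one> A) \<cdot> d A"

lemma coder_arr [simp]:
  assumes "A \<in> Obj X"
  shows "coder A \<in> Arr X" "src X (coder A) = A" "trg X (coder A) = !\<^sub>o A"
  using assms by (auto simp: coder_def)

text \<open>Inserting \<open>\<u>\<close> into the second factor of \<open>nabla_rule\<close> makes
  a unit law cancel the \<open>\<nabla>\<close> before \<open>d\<close>.\<close>

lemma d_eq_coder:
  assumes [simp]: "A \<in> Obj X"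
  shows "d A = (\<one> (!\<^sub>o A) \<otimes> coder A) \<cdot> \<nabla> A"
proof -
  have "(\<one> (!\<^sub>o A) \<otimes> coder A) \<cdot> \<nabla> A = (\<one> (!\<^sub>o A) \<otimes> \<u> A \<otimes> \<one> A) \<cdot> ((\<one> (!\<^sub>o A) \<otimes> d A) \<cdot> \<nabla> A)"
    by (simp add: coder_def interchange_head)
  also have "\<dots> = (((\<one> (!\<^sub>o A) \<otimes> \<u> A) \<cdot> \<nabla> A) \<otimes> \<one> A) \<cdot> d A"
    unfolding nabla_rule[OF assms]
    using interchange_head[of "\<one> (!\<^sub>o A) \<otimes> \<u> A" "\<one> A" "\<nabla> A" "\<one> A" "d A"] by simp
  finally show ?thesis
    by (simp add: ind_mult_unit)
qed

text \<open>The chain rule with its inner and outer \<open>d\<close> expanded by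
  \<open>d_eq_coder\<close>, regrouped into the form of the codereliction axiom.\<close>

lemma coder_comult:
  assumes [simp]: "A \<in> Obj X"
  shows "d A \<cdot> \<delta> A =
    (\<Delta> A \<otimes> coder A) \<cdot> (\<one> (!\<^sub>o A) \<otimes> \<nabla> A) \<cdot> (\<delta> A \<otimes> coder (!\<^sub>o A)) \<cdot> \<nabla> (!\<^sub>o A)"
proof -
  let ?A = "!\<^sub>o A"
  have "d A \<cdot> \<delta> A = (\<Delta> A \<otimes> \<one> A) \<cdot> (\<delta> A \<otimes> d A) \<cdot> d ?A"
    by (simp add: chain_rule)
  also have "\<dots> = (\<Delta> A \<otimes> \<one> A) \<cdot> (\<delta> A \<otimes> ((\<one> ?A \<otimes> coder A) \<cdot> (\<nabla> A \<cdot> coder ?A))) \<cdot> \<nabla> ?A"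
    by (simp add: d_eq_coder interchange_head)
  also have "\<dots> = ((\<Delta> A \<otimes> \<one> A) \<cdot> (\<one> (?A \<otimes>\<^sub>o ?A) \<otimes> coder A)) \<cdot> (\<delta> A \<otimes> (\<nabla> A \<cdot> coder ?A)) \<cdot> \<nabla> ?A"
    using interchange[of "\<one> ?A" "\<one> ?A \<otimes> coder A" "\<delta> A" "\<nabla> A \<cdot> coder ?A"]
    by simp
  also have "(\<Delta> A \<otimes> \<one> A) \<cdot> (\<one> (?A \<otimes>\<^sub>o ?A) \<otimes> coder A) = \<Delta> A \<otimes> coder A"
    by (simp add: interchange)
  also have "\<delta> A \<otimes> (\<nabla> A \<cdot> coder ?A) = (\<one> ?A \<otimes> \<nabla> A) \<cdot> (\<delta> A \<otimes> coder ?A)"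
    by (simp add: interchange)
  finally show ?thesis by simp
qed

lemma coder_dupl:
  assumes [simp]: "A \<in> Obj X"
  shows "coder A \<cdot> \<Delta> A = coder A \<otimes> \<u> A \<oplus> \<u> A \<otimes> coder A"
proof -
  let ?A = "!\<^sub>o A"
  have 1: "(\<u> A \<otimes> \<u> A \<otimes> \<one> A) \<cdot> (\<one> ?A \<otimes> d A) = \<u> A \<otimes> coder A"
    by (simp add: interchange coder_def)
  \<comment> \<open>Naturality moves \<open>\<u>\<close> through the symmetry, which is then a
    symmetry with \<open>\<K>\<close> and hence an identity.\<close>
  have "(\<u> A \<otimes> \<one> A) \<cdot> \<sigma> ?A A = \<one> A \<otimes> \<u> A"
    by (subst symm_nat[of _ _ \<K> A]) simp_all
  then have "(\<u> A \<otimes> (\<u> A \<otimes> \<one> A)) \<cdot> (\<one> ?A \<otimes> \<sigma> ?A A) = (\<u> A \<otimes> \<one> A) \<otimes> \<u> A"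
    by (subst interchange) simp_all
  then have 2: "(\<u> A \<otimes> \<u> A \<otimes> \<one> A) \<cdot> (\<one> ?A \<otimes> \<sigma> ?A A) \<cdot> (d A \<otimes> \<one> ?A) = coder A \<otimes> \<u> A"
    using interchange[of "\<u> A \<otimes> \<one> A" "\<u> A" "d A" "\<one> ?A"] by (simp add: coder_def)
  have "coder A \<cdot> \<Delta> A = ((\<u> A \<cdot> \<Delta> A) \<otimes> \<one> A) \<cdot>
      (\<one> ?A \<otimes> d A \<oplus> (\<one> ?A \<otimes> \<sigma> ?A A) \<cdot> (d A \<otimes> \<one> ?A))"
    by (simp add: coder_def product_rule interchange_head)
  also have "\<dots> = (\<u> A \<otimes> \<u> A \<otimes> \<one> A) \<cdot> (\<one> ?A \<otimes> d A) \<oplus>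
      (\<u> A \<otimes> \<u> A \<otimes> \<one> A) \<cdot> (\<one> ?A \<otimes> \<sigma> ?A A) \<cdot> (d A \<otimes> \<one> ?A)"
    by (simp add: ind_unit_dupl comp_distrib_left)
  also have "\<dots> = coder A \<otimes> \<u> A \<oplus> \<u> A \<otimes> coder A"
    unfolding 1 2 by (simp add: plus_comm)
  finally show ?thesis .
qed

lemma coder_nat:
  assumes [simp]: "f \<in> Arr X" "src X f = A" "trg X f = B"
  shows "f \<cdot> coder B = coder A \<cdot> !\<^sub>m f"
proof -
  have [simp]: "A \<in> Obj X" "B \<in> Obj X" using assms arr_obj by blast+
  have "f \<cdot> coder B = (\<u> B \<otimes> f) \<cdot> d B"
    using interchange_head[of "\<one> \<K>" f "\<u> B" "\<one> B" "d B"] by (simp add: coder_def)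
  also have "\<dots> = (\<u> A \<otimes> \<one> A) \<cdot> ((!\<^sub>m f \<otimes> f) \<cdot> d B)"
    by (simp add: interchange_head ind_unit_nat)
  also have "\<dots> = coder A \<cdot> !\<^sub>m f"
    by (simp add: d_nat coder_def)
  finally show ?thesis .
qed

theorem codereliction_coder: "codereliction X \<nabla> \<u> coder"
proof -
  \<comment> \<open>This supplies the inherited axioms, so only those about \<open>coder\<close>
    remain.\<close>
  interpret bialgebra_modality X \<nabla> \<u> by (rule bialgebra_modality_ind)
  show ?thesis
  proof unfold_locales
    fix A assume [simp]: "A \<in> Obj X"
    show "\<guillemotleft>coder A : A \<rightarrow> !\<^sub>o A\<guillemotright>" by (simp add: in_hom_def)
    show "coder A \<cdot> \<e> A = \<zero> A \<K>" by (simp add: coder_def constant_rule)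
    show "coder A \<cdot> \<epsilon> A = \<one> A" by (simp add: coder_def linear_rule interchange unit_eras)
    show "coder A \<cdot> \<Delta> A = coder A \<otimes> \<u> A \<oplus> \<u> A \<otimes> coder A" by (rule coder_dupl) simp
    show "(\<one> (!\<^sub>o A) \<otimes> coder A) \<cdot> \<nabla> A \<cdot> \<delta> A =
        (\<Delta> A \<otimes> coder A) \<cdot> (\<one> (!\<^sub>o A) \<otimes> \<nabla> A) \<cdot> (\<delta> A \<otimes> coder (!\<^sub>o A)) \<cdot> \<nabla> (!\<^sub>o A)"
      using coder_comult[of A] d_eq_coder[of A] by simp
  next
    fix f A B assume "\<guillemotleft>f : A \<rightarrow> B\<guillemotright>"
    then show "f \<cdot> coder B = coder A \<cdot> !\<^sub>m f" by (simp add: in_hom_def coder_nat)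
  qed
qed

end

theorem theorem6p12:
  fixes X :: "('o, 'm, 'z) mon_coalg_mod_scheme" (structure)
    and d :: "'o \<Rightarrow> 'm"
  assumes "additive_linear_category X"
    and "deriving_transformation X d"
  shows "(\<forall>A\<in>Obj X. \<forall>B\<in>Obj X.
            (\<one> (!\<^sub>o A) \<otimes> d B) \<cdot> m\<^sub>\<otimes> A B =
            (\<Delta> A \<otimes> \<one> (!\<^sub>o B) \<otimes> \<one> B) \<cdot>
            (\<one> (!\<^sub>o A) \<otimes> \<sigma> (!\<^sub>o A) (!\<^sub>o B) \<otimes> \<one> B) \<cdot>
            (m\<^sub>\<otimes> A B \<otimes> \<epsilon> A \<otimes> \<one> B) \<cdot>
            d (A \<otimes>\<^sub>o B)) \<and>
         (\<exists>\<eta>. codereliction X \<nabla> \<u> \<eta> \<and>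
              (\<forall>A\<in>Obj X. d A = (\<one> (!\<^sub>o A) \<otimes> \<eta> A) \<cdot> \<nabla> A))"
proof -
  interpret linear_deriving X d
    using assms by (rule linear_deriving.intro)
  show ?thesis
    using monoidal_rule codereliction_coder d_eq_coder by blast
qed

end
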